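(* Let $R=\mathbb Q[[x_1,\ldots,x_5]]$ with maximal ideal $\mathfrak m=(x_1,\ldots,x_5)$, let $\ell=x_1+\cdots+x_5$, and set $$f=\frac14\sum_{i=1}^5 x_i^4+\ell^5.$$ Let $J_f=(\partial_1 f,\ldots,\partial_5 f)$. Then $f$ defines an isolated hypersurface singularity and $$J_f:f\subseteq\overline{J_f}.$$ More precisely, $\overline{J_f}=\mathfrak m^3$.
   Context: $\partial_i f$ is the formal partial derivative with respect to $x_i$; $J_f:f=\{g\in R: gf\in J_f\}$; $\overline{J_f}$ denotes the integral closure of the ideal $J_f$ in $R$. That $f\in\mathfrak m$ defines an isolated hypersurface singularity means that $J_f$ is $\mathfrak m$-primary. *)

theory Defs
  imports
    "HOL-Library.Numeral_Type"
    "HOL-Algebra.Ideal_Product"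
    "HOL-Algebra.Algebraic_Closure_Type"
begin

section \<open>Formal power series in finitely many variables\<close>

text \<open>
  The type \<open>('a, 'n) mfps\<close> is the ring of formal power series over \<open>'a\<close> in variables indexed
  by the finite type \<open>'n\<close>. A series is the family of its coefficients; the exponent vector
  \<open>a :: 'n \<Rightarrow> nat\<close> stands for the monomial \<open>\<Prod>i. x\<^sub>i ^ a i\<close>.
\<close>

typedef (overloaded) ('a, 'n) mfps = "UNIV :: (('n \<Rightarrow> nat) \<Rightarrow> 'a) set"
  morphisms mfps_coeff Abs_mfps
  by simp

setup_lifting type_definition_mfps

lemma mfps_eqI: "(\<And>m. mfps_coeff f m = mfps_coeff g m) \<Longrightarrow> f = g"
  by transfer auto

definition exponent_splits :: "('n \<Rightarrow> nat) \<Rightarrow> (('n \<Rightarrow> nat) \<times> ('n \<Rightarrow> nat)) set" where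
  "exponent_splits m = {(a, b). \<forall>i. a i + b i = m i}"

lemma finite_exponent_splits [simp]:
  fixes m :: "'n::finite \<Rightarrow> nat"
  shows "finite (exponent_splits m)"
proof -
  let ?S = "PiE UNIV (\<lambda>i. {..m i})"
  have "finite (?S \<times> ?S)"
    by (intro finite_cartesian_product finite_PiE) auto
  moreover have "exponent_splits m \<subseteq> ?S \<times> ?S"
    by (auto simp: exponent_splits_def PiE_def Pi_def) (metis le_add1, metis le_add2)
  ultimately show ?thesis
    by (rule rev_finite_subset)
qed

instantiation mfps :: (comm_ring_1, finite) comm_ring_1
begin

lift_definition zero_mfps :: "('a, 'b) mfps" is "\<lambda>_. 0" .
lift_definition one_mfps :: "('a, 'b) mfps" is "\<lambda>m. if m = (\<lambda>_. 0) then 1 else 0" .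
lift_definition plus_mfps :: "('a, 'b) mfps \<Rightarrow> ('a, 'b) mfps \<Rightarrow> ('a, 'b) mfps"
  is "\<lambda>f g m. f m + g m" .
lift_definition minus_mfps :: "('a, 'b) mfps \<Rightarrow> ('a, 'b) mfps \<Rightarrow> ('a, 'b) mfps"
  is "\<lambda>f g m. f m - g m" .
lift_definition uminus_mfps :: "('a, 'b) mfps \<Rightarrow> ('a, 'b) mfps"
  is "\<lambda>f m. - f m" .
lift_definition times_mfps :: "('a, 'b) mfps \<Rightarrow> ('a, 'b) mfps \<Rightarrow> ('a, 'b) mfps"
  is "\<lambda>f g m. \<Sum>(a, b)\<in>exponent_splits m. f a * g b" .

instance
proof
  fix f g h :: "('a, 'b) mfps"
  show "f + g + h = f + (g + h)"
    by transfer (auto simp: add.assoc)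
  show "f + g = g + f"
    by transfer (auto simp: add.commute)
  show "0 + f = f"
    by transfer auto
  show "- f + f = 0"
    by transfer auto
  show "f - g = f + - g"
    by transfer auto
  show "(0 :: ('a, 'b) mfps) \<noteq> 1"
    by transfer (metis zero_neq_one)
  show "f * g = g * f"
  proof (transfer, rule ext)
    fix f g :: "('b \<Rightarrow> nat) \<Rightarrow> 'a" and m
    show "(\<Sum>(a, b)\<in>exponent_splits m. f a * g b) = (\<Sum>(a, b)\<in>exponent_splits m. g a * f b)"
      by (rule sum.reindex_bij_witness[of _ prod.swap prod.swap])
        (auto simp: exponent_splits_def mult.commute add.commute)
  qed
  show "1 * f = f"
  proof (transfer, rule ext)
    fix f :: "('b \<Rightarrow> nat) \<Rightarrow> 'a" and m
    have "(\<Sum>(a, b)\<in>exponent_splits m. (if a = (\<lambda>_. 0) then 1 else 0) * f b)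
        = (\<Sum>(a, b)\<in>{(\<lambda>_::'b. 0::nat, m)}. (if a = (\<lambda>_. 0) then 1 else 0) * f b)"
    proof (rule sum.mono_neutral_right)
      show "{(\<lambda>_::'b. 0::nat, m)} \<subseteq> exponent_splits m"
        by (auto simp: exponent_splits_def)
    qed (auto simp: exponent_splits_def[of m] fun_eq_iff simp del: split_paired_All
        intro: finite_exponent_splits[of m, unfolded exponent_splits_def] split: if_splits)
    then show "(\<Sum>(a, b)\<in>exponent_splits m. (if a = (\<lambda>_. 0) then 1 else 0) * f b) = f m"
      by simp
  qed
  show "(f + g) * h = f * h + g * h"
    by transfer (simp add: case_prod_unfold distrib_right sum.distrib)
  show "f * g * h = f * (g * h)"
  proof (transfer, rule ext)
    fix f g h :: "('b \<Rightarrow> nat) \<Rightarrow> 'a" and m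
    let ?D = "exponent_splits :: ('b \<Rightarrow> nat) \<Rightarrow> _"
    have "(\<Sum>(a, b)\<in>?D m. (\<Sum>(c, d)\<in>?D a. f c * g d) * h b)
        = (\<Sum>p\<in>?D m. \<Sum>q\<in>?D (fst p). f (fst q) * g (snd q) * h (snd p))"
      by (simp add: case_prod_unfold sum_distrib_right)
    also have "\<dots> = (\<Sum>(p, q)\<in>Sigma (?D m) (\<lambda>p. ?D (fst p)). f (fst q) * g (snd q) * h (snd p))"
      by (subst sum.Sigma) auto
    also have "\<dots> = (\<Sum>(p, q)\<in>Sigma (?D m) (\<lambda>p. ?D (snd p)). f (fst p) * (g (fst q) * h (snd q)))"
      by (rule sum.reindex_bij_witness[of _
            "\<lambda>(p, q). ((\<lambda>i. fst p i + fst q i, snd q), (fst p, fst q))"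
            "\<lambda>(p, q). ((fst q, \<lambda>i. snd q i + snd p i), (snd q, snd p))"])
        (auto simp: exponent_splits_def mult.assoc add.assoc, metis add.assoc)
    also have "\<dots> = (\<Sum>p\<in>?D m. \<Sum>q\<in>?D (snd p). f (fst p) * (g (fst q) * h (snd q)))"
      by (subst sum.Sigma) auto
    also have "\<dots> = (\<Sum>(a, b)\<in>?D m. f a * (\<Sum>(c, d)\<in>?D b. g c * h d))"
      by (simp add: case_prod_unfold sum_distrib_left)
    finally show "(\<Sum>(a, b)\<in>?D m. (\<Sum>(c, d)\<in>?D a. f c * g d) * h b)
        = (\<Sum>(a, b)\<in>?D m. f a * (\<Sum>(c, d)\<in>?D b. g c * h d))" .
  qed
qed

end

lift_definition mfps_const :: "'a::zero \<Rightarrow> ('a, 'n) mfps"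
  is "\<lambda>c m. if m = (\<lambda>_. 0) then c else 0" .

lift_definition mfps_X :: "'n \<Rightarrow> ('a::zero_neq_one, 'n) mfps"
  is "\<lambda>i m. if m = (\<lambda>_. 0)(i := 1) then 1 else 0" .

text \<open>
  Formal partial derivative: the term \<open>c x\<^sup>a\<close> of \<open>f\<close> contributes \<open>a\<^sub>i c\<close> to the monomial with
  exponent \<open>a - e\<^sub>i\<close>, so the coefficient at \<open>m\<close> comes from the exponent \<open>m + e\<^sub>i\<close>.
\<close>
lift_definition mfps_pderiv :: "'n \<Rightarrow> ('a::comm_ring_1, 'n) mfps \<Rightarrow> ('a, 'n) mfps"
  is "\<lambda>i f m. of_nat (Suc (m i)) * f (m(i := Suc (m i)))" .


section \<open>Ideal-theoretic notions\<close>

definition ideal_power :: "('a, 'b) ring_scheme \<Rightarrow> 'a set \<Rightarrow> nat \<Rightarrow> 'a set" where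
  "ideal_power R I n = I [^]\<^bsub>ideals_set R\<^esub> n"

definition colon_elem :: "('a, 'b) ring_scheme \<Rightarrow> 'a set \<Rightarrow> 'a \<Rightarrow> 'a set" where
  "colon_elem R I f = {g \<in> carrier R. g \<otimes>\<^bsub>R\<^esub> f \<in> I}"

definition radical :: "('a, 'b) ring_scheme \<Rightarrow> 'a set \<Rightarrow> 'a set" where
  "radical R I = {r \<in> carrier R. \<exists>n::nat. r [^]\<^bsub>R\<^esub> n \<in> I}"

definition primary_ideal :: "('a, 'b) ring_scheme \<Rightarrow> 'a set \<Rightarrow> bool" where
  "primary_ideal R Q \<longleftrightarrow> ideal Q R \<and> Q \<noteq> carrier R \<and>
     (\<forall>a\<in>carrier R. \<forall>b\<in>carrier R. a \<otimes>\<^bsub>R\<^esub> b \<in> Q \<longrightarrow> a \<in> Q \<or> b \<in> radical R Q)"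

definition primary_to :: "('a, 'b) ring_scheme \<Rightarrow> 'a set \<Rightarrow> 'a set \<Rightarrow> bool" where
  "primary_to R P Q \<longleftrightarrow> primary_ideal R Q \<and> radical R Q = P"

text \<open>
  The integral closure of \<open>I\<close> in \<open>R\<close>: all \<open>r\<close> satisfying an equation
  \<open>r\<^sup>n + a\<^sub>1 r\<^sup>n\<^sup>-\<^sup>1 + \<dots> + a\<^sub>n = 0\<close> with \<open>n \<ge> 1\<close> and \<open>a\<^sub>i \<in> I\<^sup>i\<close>.
\<close>
definition integral_closure :: "('a, 'b) ring_scheme \<Rightarrow> 'a set \<Rightarrow> 'a set" where
  "integral_closure R I = {r \<in> carrier R. \<exists>n::nat. \<exists>a. n \<ge> 1 \<and>
     (\<forall>i\<in>{1..n}. a i \<in> ideal_power R I i) \<and>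
     r [^]\<^bsub>R\<^esub> n \<oplus>\<^bsub>R\<^esub> (\<Oplus>\<^bsub>R\<^esub>i\<in>{1..n}. a i \<otimes>\<^bsub>R\<^esub> r [^]\<^bsub>R\<^esub> (n - i)) = \<zero>\<^bsub>R\<^esub>}"


section \<open>Hypersurface singularities\<close>

abbreviation mfps_ring :: "('a::comm_ring_1, 'n::finite) mfps ring" where
  "mfps_ring \<equiv> ring_of_type_algebra"

definition mfps_max_ideal :: "('a::field, 'n::finite) mfps set" where
  "mfps_max_ideal = Idl\<^bsub>mfps_ring\<^esub> (range mfps_X)"

definition jacobian_ideal :: "('a::field, 'n::finite) mfps \<Rightarrow> ('a, 'n) mfps set" where
  "jacobian_ideal f = Idl\<^bsub>mfps_ring\<^esub> (range (\<lambda>i. mfps_pderiv i f))"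

definition isolated_hypersurface_singularity :: "('a::field, 'n::finite) mfps \<Rightarrow> bool" where
  "isolated_hypersurface_singularity f \<longleftrightarrow>
     f \<in> mfps_max_ideal \<and> primary_to mfps_ring mfps_max_ideal (jacobian_ideal f)"

end

theory Submission
  imports Defs "Jordan_Normal_Form.Char_Poly"
begin

text \<open>
  The partial derivatives are \<open>f\<^sub>i = x\<^sub>i\<^sup>3 + 5 \<ell>\<^sup>4\<close>. Every monomial of degree at least 11 is divisible
  by some \<open>x\<^sub>i\<^sup>3\<close>, so a Nakayama argument gives \<open>\<mm>\<^sup>1\<^sup>1 = J \<mm>\<^sup>8\<close>; hence \<open>J\<close> is primary to \<open>\<mm>\<close>, and the
  determinant trick on \<open>\<mm>\<^sup>8\<close> shows that \<open>\<mm>\<^sup>3\<close> is integral over \<open>J\<close>. Conversely \<open>J \<subseteq> \<mm>\<^sup>3\<close>, and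
  \<open>\<mm>\<^sup>3\<close> is integrally closed because the order of a power series is a valuation.

  By Euler's formula \<open>4 f \<equiv> - \<ell>\<^sup>5\<close> modulo \<open>J\<close>, so \<open>J : f = J : \<ell>\<^sup>5\<close>. If this ideal contained a
  series of order less than 3, then also one of order exactly 2. Comparing terms of degree 7,
  its quadratic part would be killed by \<open>\<ell>\<^sup>5\<close> modulo the cubes \<open>x\<^sub>i\<^sup>3\<close>, which contradicts the
  strong Lefschetz property of \<open>\<rat>[x\<^sub>1, \<dots>, x\<^sub>5] / (x\<^sub>1\<^sup>3, \<dots>, x\<^sub>5\<^sup>3)\<close>.
\<close>

section \<open>Ideals of a commutative ring type\<close>

lemma ring_of_type_algebra_simps [simp]:
  "carrier ring_of_type_algebra = UNIV"
  "x \<otimes>\<^bsub>ring_of_type_algebra\<^esub> y = x * y"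
  "x \<oplus>\<^bsub>ring_of_type_algebra\<^esub> y = x + y"
  "\<one>\<^bsub>ring_of_type_algebra\<^esub> = 1"
  "\<zero>\<^bsub>ring_of_type_algebra\<^esub> = 0"
  by (simp_all add: ring_of_type_algebra_def)

lemma cring_type: "cring (ring_of_type_algebra :: 'a::comm_ring_1 ring)"
  by (rule cring_from_type_algebra)

lemma nat_pow_type [simp]:
  "x [^]\<^bsub>ring_of_type_algebra\<^esub> (n::nat) = (x :: 'a::comm_ring_1) ^ n"
proof -
  interpret cring "ring_of_type_algebra :: 'a ring" by (rule cring_type)
  show ?thesis by (induction n) (simp_all add: mult.commute)
qed

lemma finsum_type [simp]:
  fixes g :: "'b \<Rightarrow> 'a::comm_ring_1"
  shows "finite A \<Longrightarrow> finsum ring_of_type_algebra g A = sum g A"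
proof (induction A rule: finite_induct)
  interpret cring "ring_of_type_algebra :: 'a ring" by (rule cring_type)
  {
    case empty
    show ?case by (simp del: ring_of_type_algebra_simps(5)) simp
  next
    case (insert x F)
    then show ?case by (subst finsum_insert) auto
  }
qed

lemma ideal_type_iff:
  "ideal I (ring_of_type_algebra :: 'a::comm_ring_1 ring) \<longleftrightarrow>
    0 \<in> I \<and> (\<forall>x\<in>I. \<forall>y\<in>I. x + y \<in> I) \<and> (\<forall>a. \<forall>x\<in>I. a * x \<in> I)" (is "?L \<longleftrightarrow> ?R")
proof
  assume ?L
  then interpret ideal I "ring_of_type_algebra :: 'a ring" .
  show ?R
    using additive_subgroup.zero_closed[OF is_additive_subgroup]
      additive_subgroup.a_closed[OF is_additive_subgroup] I_l_closed by simp
next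
  assume R: ?R
  interpret cring "ring_of_type_algebra :: 'a ring" by (rule cring_type)
  show ?L
  proof (rule idealI)
    show "subgroup I (add_monoid (ring_of_type_algebra :: 'a ring))"
    proof (rule add.subgroupI)
      fix x assume "x \<in> I"
      moreover have "\<ominus>\<^bsub>ring_of_type_algebra\<^esub> x = - x"
        by (rule minus_equality) auto
      ultimately show "\<ominus>\<^bsub>ring_of_type_algebra\<^esub> x \<in> I"
        using R[THEN conjunct2, THEN conjunct2, rule_format, of x "- 1"] by simp
    qed (use R in auto)
  next
    fix a x assume "a \<in> I"
    then show "x \<otimes>\<^bsub>ring_of_type_algebra\<^esub> a \<in> I" "a \<otimes>\<^bsub>ring_of_type_algebra\<^esub> x \<in> I"
      using R by (auto simp: mult.commute[of a x])
  qed (rule ring_axioms)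
qed

lemmas ideal_typeD =
  ideal_type_iff[THEN iffD1, THEN conjunct1]
  ideal_type_iff[THEN iffD1, THEN conjunct2, THEN conjunct1, rule_format]
  ideal_type_iff[THEN iffD1, THEN conjunct2, THEN conjunct2, rule_format]

lemma ideal_type_uminus:
  assumes "ideal I (ring_of_type_algebra :: 'a::comm_ring_1 ring)" "x \<in> I"
  shows "- x \<in> I"
  using ideal_typeD(3)[OF assms, of "- 1"] by simp

lemma ideal_type_diff:
  assumes "ideal I (ring_of_type_algebra :: 'a::comm_ring_1 ring)" "x \<in> I" "y \<in> I"
  shows "x - y \<in> I"
  using ideal_typeD(2)[OF assms(1,2) ideal_type_uminus[OF assms(1,3)]] by simp

lemma ideal_type_sum:
  assumes "ideal I (ring_of_type_algebra :: 'a::comm_ring_1 ring)" "\<And>i. i \<in> A \<Longrightarrow> g i \<in> I"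
  shows "sum g A \<in> I"
  using assms(2) by (induction A rule: infinite_finite_induct) (simp_all add: ideal_typeD(1,2)[OF assms(1)])

lemma genideal_range_type:
  fixes g :: "'i::finite \<Rightarrow> 'a::comm_ring_1"
  shows "Idl\<^bsub>ring_of_type_algebra\<^esub> (range g) = {\<Sum>i\<in>UNIV. c i * g i |c. True}" (is "_ = ?S")
proof
  interpret cring "ring_of_type_algebra :: 'a ring" by (rule cring_type)
  have I: "ideal (Idl\<^bsub>ring_of_type_algebra\<^esub> (range g)) ring_of_type_algebra"
    by (rule genideal_ideal) simp
  have gen: "g i \<in> Idl\<^bsub>ring_of_type_algebra\<^esub> (range g)" for i
    using genideal_self[of "range g"] by auto
  show "?S \<subseteq> Idl\<^bsub>ring_of_type_algebra\<^esub> (range g)"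
    by (auto intro!: ideal_type_sum[OF I] ideal_typeD(3)[OF I] gen)
  show "Idl\<^bsub>ring_of_type_algebra\<^esub> (range g) \<subseteq> ?S"
  proof (rule genideal_minimal)
    show "ideal ?S ring_of_type_algebra"
      unfolding ideal_type_iff
    proof (intro conjI ballI allI)
      show "0 \<in> ?S"
        by (auto intro!: exI[of _ "\<lambda>_. 0"])
    next
      fix x y assume "x \<in> ?S" "y \<in> ?S"
      then obtain c d where "x = (\<Sum>i\<in>UNIV. c i * g i)" "y = (\<Sum>i\<in>UNIV. d i * g i)"
        by auto
      then have "x + y = (\<Sum>i\<in>UNIV. (c i + d i) * g i)"
        by (simp add: distrib_right sum.distrib)
      then show "x + y \<in> ?S" by auto
    next
      fix a x assume "x \<in> ?S"
      then obtain c where "x = (\<Sum>i\<in>UNIV. c i * g i)"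
        by auto
      then have "a * x = (\<Sum>i\<in>UNIV. (a * c i) * g i)"
        by (simp add: sum_distrib_left mult.assoc)
      then show "a * x \<in> ?S" by auto
    qed
    show "range g \<subseteq> ?S"
    proof
      fix x assume "x \<in> range g"
      then obtain j where "x = g j" by auto
      then have "x = (\<Sum>i\<in>UNIV. (if i = j then 1 else 0) * g i)"
        by (simp add: if_distrib[of "\<lambda>c. c * _"] cong: if_cong)
      then show "x \<in> ?S" by (auto intro: exI[of _ "\<lambda>i. if i = j then 1 else 0"])
    qed
  qed
qed

lemma ideal_power_0 [simp]: "ideal_power (ring_of_type_algebra :: 'a::comm_ring_1 ring) I 0 = UNIV"
  by (simp add: ideal_power_def ideals_set_def)

lemma ideal_power_Suc:
  "ideal_power (ring_of_type_algebra :: 'a::comm_ring_1 ring) I (Suc n) =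
    ideal_prod ring_of_type_algebra (ideal_power ring_of_type_algebra I n) I"
  by (simp add: ideal_power_def ideals_set_def)

context
  fixes I :: "'a::comm_ring_1 set"
  assumes I: "ideal I (ring_of_type_algebra :: 'a ring)"
begin

lemma ideal_ideal_power: "ideal (ideal_power ring_of_type_algebra I n) ring_of_type_algebra"
proof (induction n)
  case 0
  show ?case by (simp add: ideal_type_iff)
next
  case (Suc n)
  interpret cring "ring_of_type_algebra :: 'a ring" by (rule cring_type)
  show ?case
    unfolding ideal_power_Suc by (rule ideal_prod_is_ideal[OF Suc I])
qed

lemma ideal_power_mult:
  assumes "x \<in> ideal_power ring_of_type_algebra I n" "y \<in> ideal_power ring_of_type_algebra I m"
  shows "x * y \<in> ideal_power ring_of_type_algebra I (n + m)"
  using assms(2)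
proof (induction m arbitrary: y)
  case 0
  then show ?case
    using ideal_typeD(3)[OF ideal_ideal_power assms(1), of y] by (simp add: mult.commute)
next
  case (Suc m)
  from Suc.prems[unfolded ideal_power_Suc] show ?case
  proof (induction y rule: ideal_prod.induct)
    case (prod i j)
    have "(x * i) \<otimes>\<^bsub>ring_of_type_algebra\<^esub> j \<in> ideal_power ring_of_type_algebra I (Suc (n + m))"
      unfolding ideal_power_Suc by (intro ideal_prod.prod Suc.IH prod)
    then show ?case by (simp add: mult.assoc)
  next
    case (sum s1 s2)
    then show ?case
      using ideal_typeD(2)[OF ideal_ideal_power] by (simp add: distrib_left)
  qed
qed

lemma ideal_power_1: "x \<in> I \<Longrightarrow> x \<in> ideal_power ring_of_type_algebra I (Suc 0)"
  using ideal_prod.prod[of 1 UNIV x I ring_of_type_algebra] by (simp add: ideal_power_Suc)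

lemma ideal_power_antimono:
  "m \<le> n \<Longrightarrow> ideal_power ring_of_type_algebra I n \<subseteq> ideal_power ring_of_type_algebra I m"
proof (induction n rule: dec_induct)
  case (step n)
  interpret cring "ring_of_type_algebra :: 'a ring" by (rule cring_type)
  have "ideal_power ring_of_type_algebra I (Suc n) \<subseteq> ideal_power ring_of_type_algebra I n"
    unfolding ideal_power_Suc using ideal_prod_inter[OF ideal_ideal_power I] by blast
  with step show ?case by blast
qed simp

end

lemma ideal_power_subset:
  assumes "I \<subseteq> K"
  shows "ideal_power (ring_of_type_algebra :: 'a::comm_ring_1 ring) I n \<subseteq> ideal_power ring_of_type_algebra K n"
proof (induction n)
  case (Suc n)
  show ?case
  proof
    fix x assume "x \<in> ideal_power ring_of_type_algebra I (Suc n)"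
    then show "x \<in> ideal_power ring_of_type_algebra K (Suc n)"
      unfolding ideal_power_Suc
      by (induction rule: ideal_prod.induct) (use Suc assms in \<open>blast intro: ideal_prod.intros\<close>)+
  qed
qed simp


section \<open>The determinant trick\<close>

text \<open>The matrix B = r I - M kills v. Multiplying by the adjugate of B gives det B * v = 0,
  and det B is the characteristic polynomial at r because evaluation is a ring homomorphism. No
  division occurs.\<close>

lemma char_poly_annihilates:
  fixes M :: "'a::comm_ring_1 mat"
  assumes M: "M \<in> carrier_mat n n" and v: "v \<in> carrier_vec n"
    and ev: "M *\<^sub>v v = r \<cdot>\<^sub>v v" and i: "i < n"
  shows "poly (char_poly M) r * vec_index v i = 0"
proof -
  define B where "B = map_mat (\<lambda>p. poly p r) (char_poly_matrix M)"
  have B: "B \<in> carrier_mat n n"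
    using M by (simp add: B_def)
  have B_eq: "B = r \<cdot>\<^sub>m 1\<^sub>m n - M"
    using M by (intro eq_matI) (auto simp: B_def char_poly_matrix_def)
  have smult_one: "(c \<cdot>\<^sub>m 1\<^sub>m n) *\<^sub>v v = c \<cdot>\<^sub>v v" for c :: 'a
    using v by (intro eq_vecI) (auto simp: scalar_prod_def if_distrib if_distribR cong: if_cong)
  have "B *\<^sub>v v = 0\<^sub>v n"
    unfolding B_eq
    by (subst minus_mult_distrib_mat_vec[OF _ M v]) (use v in \<open>simp_all add: smult_one ev\<close>)
  then have "(adj_mat B * B) *\<^sub>v v = 0\<^sub>v n"
    using adj_mat(1)[OF B] B v by (subst assoc_mult_mat_vec) auto
  then have "(det B \<cdot>\<^sub>m 1\<^sub>m n) *\<^sub>v v = 0\<^sub>v n"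
    by (simp add: adj_mat(3)[OF B])
  then have "det B \<cdot>\<^sub>v v = 0\<^sub>v n"
    by (simp add: smult_one)
  then have "vec_index (det B \<cdot>\<^sub>v v) i = 0"
    using i by simp
  moreover have "det B = poly (char_poly M) r"
    by (simp add: B_def char_poly_def comm_ring_hom.hom_det[OF poly_hom.comm_ring_hom_axioms])
  ultimately show ?thesis
    using v i by simp
qed

text \<open>Give weight one to the polynomial variable and to the elements of I. The entries of the
  characteristic matrix then have weight at least one, so each product of n entries in the
  determinant has weight at least n.\<close>

lemma coeff_char_poly_in_ideal_power:
  fixes M :: "'a::comm_ring_1 mat"
  assumes I: "ideal I (ring_of_type_algebra :: 'a ring)"
    and M: "M \<in> carrier_mat n n"
    and M_in: "\<And>i j. i < n \<Longrightarrow> j < n \<Longrightarrow> M $$ (i, j) \<in> I"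
  shows "Polynomial.coeff (char_poly M) k \<in> ideal_power ring_of_type_algebra I (n - k)"
proof -
  define P where "P = ideal_power (ring_of_type_algebra :: 'a ring) I"
  \<comment> \<open>Polynomials of weight at least d. Truncated subtraction imposes no condition for
    k >= d, since the zeroth power of I is the whole ring.\<close>
  define S where "S d = {p. \<forall>k. Polynomial.coeff p k \<in> P (d - k)}" for d :: nat
  have P: "ideal (P d) ring_of_type_algebra" for d
    unfolding P_def by (rule ideal_ideal_power[OF I])
  have S_mult: "p * q \<in> S (d + e)" if pq: "p \<in> S d" "q \<in> S e" for p q d e
  proof -
    have "Polynomial.coeff p i * Polynomial.coeff q (k - i) \<in> P (d + e - k)" if "i \<le> k" for i k
    proof -
      have "Polynomial.coeff p i * Polynomial.coeff q (k - i) \<in> P ((d - i) + (e - (k - i)))"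
        unfolding P_def by (rule ideal_power_mult[OF I]) (use pq in \<open>auto simp: S_def P_def\<close>)
      moreover have "d + e - k \<le> (d - i) + (e - (k - i))"
        using that by simp
      ultimately show ?thesis
        unfolding P_def using ideal_power_antimono[OF I] by blast
    qed
    then show ?thesis
      by (auto simp: S_def coeff_mult intro!: ideal_type_sum[OF P])
  qed
  have S_sum: "sum g A \<in> S d" if "\<And>i. i \<in> A \<Longrightarrow> g i \<in> S d" for g :: "'b \<Rightarrow> 'a poly" and A d
    using that by (auto simp: S_def coeff_sum intro!: ideal_type_sum[OF P])
  have S_1: "1 \<in> S 0"
    by (simp add: S_def P_def)
  have S_prod: "prod g A \<in> S (card A)" if "finite A" "\<And>i. i \<in> A \<Longrightarrow> g i \<in> S 1"
    for g :: "nat \<Rightarrow> 'a poly" and A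
    using that
  proof (induction A rule: finite_induct)
    case (insert x F)
    then show ?case
      using S_mult[of "g x" 1 "prod g F" "card F"] by simp
  qed (simp add: S_1)
  have entry: "char_poly_matrix M $$ (i, j) \<in> S 1" if "i < n" "j < n" for i j
  proof -
    have "- M $$ (i, j) \<in> P 1"
      unfolding P_def using ideal_power_1[OF I ideal_type_uminus[OF I M_in[OF that]]] by simp
    moreover have "char_poly_matrix M $$ (i, j) =
        (if i = j then [:- M $$ (i, j), 1:] else [:- M $$ (i, j):])"
      using that M by (auto simp: char_poly_matrix_def)
    moreover have "0 \<in> P d" "1 \<in> P 0" for d
      using ideal_typeD(1)[OF P] by (auto simp: P_def)
    ultimately show ?thesis
      by (auto simp: S_def coeff_pCons split: nat.split)
  qed
  have "signof p \<in> S 0" for p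
    by (auto simp: S_def P_def)
  then have "signof p * (\<Prod>i = 0..<n. char_poly_matrix M $$ (i, p i)) \<in> S (0 + n)"
    if "p permutes {0..<n}" for p
    using S_prod[of "{0..<n}" "\<lambda>i. char_poly_matrix M $$ (i, p i)"] entry permutes_in_image[OF that]
    by (intro S_mult) auto
  then have "char_poly M \<in> S n"
    unfolding char_poly_def using M by (subst det_def'[of _ n]) (auto intro!: S_sum)
  then show ?thesis
    by (auto simp: S_def P_def)
qed

text \<open>Multiplication by r acts on the \<open>v b\<close> through a matrix over I, so the
  characteristic polynomial at r kills every \<open>v b\<close>. The regular element
  \<open>v b0\<close> forces this value to be zero, and the weights of the coefficients make it an
  equation of integral dependence.\<close>

lemma integral_closure_determinant_trick:
  fixes v :: "'b \<Rightarrow> 'a::comm_ring_1"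
  assumes I: "ideal I (ring_of_type_algebra :: 'a ring)" and V: "finite V"
    and C_in: "\<And>b b'. b \<in> V \<Longrightarrow> b' \<in> V \<Longrightarrow> C b b' \<in> I"
    and eq: "\<And>b. b \<in> V \<Longrightarrow> r * v b = (\<Sum>b'\<in>V. C b b' * v b')"
    and b0: "b0 \<in> V" and reg: "\<And>x. x * v b0 = 0 \<Longrightarrow> x = 0"
  shows "r \<in> integral_closure ring_of_type_algebra I"
proof -
  define n where "n = card V"
  obtain h where h: "bij_betw h {0..<n} V"
    unfolding n_def using ex_bij_betw_nat_finite[OF V] by blast
  then have hV: "h i \<in> V" if "i < n" for i
    using that by (auto simp: bij_betw_def)
  define M where "M = mat n n (\<lambda>(i, j). C (h i) (h j))"
  define w where "w = vec n (\<lambda>i. v (h i))"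
  have M: "M \<in> carrier_mat n n" and w: "w \<in> carrier_vec n"
    by (auto simp: M_def w_def)
  have "M *\<^sub>v w = r \<cdot>\<^sub>v w"
  proof (rule eq_vecI)
    fix i assume "i < dim_vec (r \<cdot>\<^sub>v w)"
    then have i: "i < n" by (simp add: w_def)
    have "vec_index (M *\<^sub>v w) i = (\<Sum>j = 0..<n. C (h i) (h j) * v (h j))"
      using i by (simp add: M_def w_def scalar_prod_def)
    also have "\<dots> = (\<Sum>b'\<in>V. C (h i) b' * v b')"
      by (rule sum.reindex_bij_betw[OF h])
    also have "\<dots> = r * v (h i)"
      using eq[OF hV[OF i]] by simp
    finally show "vec_index (M *\<^sub>v w) i = vec_index (r \<cdot>\<^sub>v w) i"
      using i by (simp add: w_def)
  qed (simp add: M_def w_def)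
  note annihilates = char_poly_annihilates[OF M w this]
  obtain i0 where i0: "i0 < n" "h i0 = b0"
    using h b0 by (auto simp: bij_betw_def)
  have root: "poly (char_poly M) r = 0"
    using annihilates[OF i0(1)] i0 by (auto intro: reg[of "poly (char_poly M) r"] simp: w_def)
  \<comment> \<open>Reversed numbering: \<open>c i\<close> is the coefficient of r^(n - i), as in
    the definition of the integral closure.\<close>
  define c where "c i = Polynomial.coeff (char_poly M) (n - i)" for i
  have deg: "Polynomial.degree (char_poly M) = n" and c0: "c 0 = 1"
    using degree_monic_char_poly[OF M] by (auto simp: c_def)
  have "poly (char_poly M) r = (\<Sum>i\<le>n. Polynomial.coeff (char_poly M) i * r ^ i)"
    by (simp add: poly_altdef deg)
  also have "\<dots> = (\<Sum>i\<le>n. c i * r ^ (n - i))"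
    by (rule sum.reindex_bij_witness[of _ "\<lambda>i. n - i" "\<lambda>i. n - i"]) (auto simp: c_def)
  also have "{..n} = insert 0 {1..n}"
    by auto
  finally have "r ^ n + (\<Sum>i\<in>{1..n}. c i * r ^ (n - i)) = 0"
    using root by (simp add: c0)
  moreover have "c i \<in> ideal_power ring_of_type_algebra I i" if "i \<in> {1..n}" for i
  proof -
    have "M $$ (i, j) \<in> I" if "i < n" "j < n" for i j
      using that C_in hV by (simp add: M_def)
    from coeff_char_poly_in_ideal_power[OF I M this, of "n - i"] show ?thesis
      using that by (simp add: c_def)
  qed
  moreover have "n \<ge> 1"
    using i0 by simp
  ultimately show ?thesis
    unfolding integral_closure_def by (auto intro!: exI[of _ n] exI[of _ c])
qed

section \<open>Orders and monomials of power series\<close>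

definition mdeg :: "('n::finite \<Rightarrow> nat) \<Rightarrow> nat" where
  "mdeg m = (\<Sum>i\<in>UNIV. m i)"

text \<open>A coefficientwise description of the n-th power of the maximal ideal;
  \<open>max_ideal_power_eq\<close> identifies the two. Working with this filtration avoids
  assigning an order to the zero series.\<close>

definition ord_ge :: "nat \<Rightarrow> ('a::comm_ring_1, 'n::finite) mfps set" where
  "ord_ge n = {g. \<forall>m. mdeg m < n \<longrightarrow> mfps_coeff g m = 0}"

definition mfps_monom :: "('n::finite \<Rightarrow> nat) \<Rightarrow> ('a::comm_ring_1, 'n) mfps" where
  "mfps_monom b = Abs_mfps (\<lambda>m. if m = b then 1 else 0)"

lemma mfps_coeff_monom: "mfps_coeff (mfps_monom b) m = (if m = b then 1 else 0)"
  by (simp add: mfps_monom_def Abs_mfps_inverse)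

lemma mfps_coeff_Abs [simp]: "mfps_coeff (Abs_mfps h) = h"
  by (simp add: Abs_mfps_inverse)

lemmas mfps_coeff_simps [simp] =
  zero_mfps.rep_eq one_mfps.rep_eq plus_mfps.rep_eq minus_mfps.rep_eq uminus_mfps.rep_eq

lemma mfps_coeff_sum [simp]:
  "mfps_coeff (sum g A) m = (\<Sum>i\<in>A. mfps_coeff (g i) m)"
  by (induction A rule: infinite_finite_induct) auto

lemma mfps_coeff_mult:
  "mfps_coeff (g * h) m = (\<Sum>(a, b)\<in>exponent_splits m. mfps_coeff g a * mfps_coeff h b)"
  by (simp add: times_mfps.rep_eq)

lemma mdeg_add [simp]: "mdeg (\<lambda>i. a i + b i) = mdeg a + mdeg b"
  by (simp add: mdeg_def sum.distrib)

lemma mdeg_splits: "(a, b) \<in> exponent_splits m \<Longrightarrow> mdeg m = mdeg a + mdeg b"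
  by (simp add: exponent_splits_def mdeg_def flip: sum.distrib)

lemma mdeg_zero [simp]: "mdeg (\<lambda>_. 0) = 0"
  by (simp add: mdeg_def)

lemma mdeg_eq_0_iff: "mdeg m = 0 \<longleftrightarrow> m = (\<lambda>_. 0)"
  by (auto simp: mdeg_def)

lemma mdeg_single [simp]: "mdeg ((\<lambda>_. 0)(i := k)) = k"
  by (simp add: mdeg_def fun_upd_def)

text \<open>Only one splitting of m can contribute. Monomials and constants are both supported at a
  single exponent.\<close>

lemma mfps_coeff_mult_single:
  assumes "\<And>a. a \<noteq> b \<Longrightarrow> mfps_coeff g a = 0"
  shows "mfps_coeff (g * h) m =
    (if b \<le> m then mfps_coeff g b * mfps_coeff h (\<lambda>i. m i - b i) else 0)"
proof -
  have "mfps_coeff (g * h) m =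
      (\<Sum>(a, c)\<in>(if b \<le> m then {(b, \<lambda>i. m i - b i)} else {}). mfps_coeff g a * mfps_coeff h c)"
    unfolding mfps_coeff_mult
  proof (rule sum.mono_neutral_right)
    show "\<forall>p\<in>exponent_splits m - (if b \<le> m then {(b, \<lambda>i. m i - b i)} else {}).
        (case p of (a, c) \<Rightarrow> mfps_coeff g a * mfps_coeff h c) = 0"
    proof (clarify)
      fix a c assume ac: "(a, c) \<in> exponent_splits m"
        and n: "(a, c) \<notin> (if b \<le> m then {(b, \<lambda>i. m i - b i)} else {})"
      have eq: "m i = a i + c i" for i
        using ac by (simp add: exponent_splits_def)
      then have "a \<le> m" "c = (\<lambda>i. m i - a i)"
        by (auto simp: le_fun_def)
      with n have "a \<noteq> b" by auto
      then show "mfps_coeff g a * mfps_coeff h c = 0"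
        using assms by simp
    qed
  qed (simp, auto simp: exponent_splits_def le_fun_def)
  then show ?thesis by simp
qed

lemma mfps_coeff_monom_mult:
  "mfps_coeff (mfps_monom b * h) m = (if b \<le> m then mfps_coeff h (\<lambda>i. m i - b i) else 0)"
  by (subst mfps_coeff_mult_single[of b]) (auto simp: mfps_coeff_monom)

lemma mfps_coeff_const_mult: "mfps_coeff (mfps_const c * h) m = c * mfps_coeff h m"
  by (subst mfps_coeff_mult_single[of "\<lambda>_. 0"]) (auto simp: mfps_const.rep_eq le_fun_def)

text \<open>Multiplication by a monomial shifts the coefficients injectively; this is the regularity
  required by the determinant trick.\<close>

lemma monom_mult_eq_0D: "h * mfps_monom b = 0 \<Longrightarrow> h = 0"
proof (rule mfps_eqI)
  fix m assume "h * mfps_monom b = 0"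
  then have "mfps_coeff (mfps_monom b * h) (\<lambda>i. m i + b i) = 0"
    by (simp add: mult.commute)
  then show "mfps_coeff h m = mfps_coeff 0 m"
    by (simp add: mfps_coeff_monom_mult le_fun_def)
qed

lemma monom_mult_monom: "mfps_monom a * mfps_monom b = mfps_monom (\<lambda>i. a i + b i)"
  by (rule mfps_eqI) (auto simp: mfps_coeff_monom_mult mfps_coeff_monom le_fun_def fun_eq_iff;
      metis le_add_diff_inverse)

lemma X_power_eq_monom: "mfps_X i ^ k = (mfps_monom ((\<lambda>_. 0)(i := k)) :: ('a::comm_ring_1, 'n::finite) mfps)"
proof (induction k)
  case 0
  show ?case by (rule mfps_eqI) (auto simp: mfps_coeff_monom fun_eq_iff)
next
  case (Suc k)
  have "mfps_X i = (mfps_monom ((\<lambda>_. 0)(i := 1)) :: ('a, 'n) mfps)"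
    by (rule mfps_eqI) (simp add: mfps_coeff_monom mfps_X.rep_eq)
  with Suc show ?case
    by (auto simp: monom_mult_monom intro!: arg_cong[of _ _ mfps_monom])
qed

lemma single_le_iff: "(\<lambda>_. 0)(i := k) \<le> m \<longleftrightarrow> k \<le> (m i :: nat)"
  by (auto simp: le_fun_def)

lemma mfps_coeff_X_power_mult:
  "mfps_coeff (mfps_X i ^ k * (h :: ('a::comm_ring_1, 'n::finite) mfps)) m =
    (if k \<le> m i then mfps_coeff h (m(i := m i - k)) else 0)"
  by (auto simp: X_power_eq_monom mfps_coeff_monom_mult single_le_iff
      intro!: arg_cong[of _ _ "mfps_coeff h"])

lemma mfps_coeff_X_mult:
  "mfps_coeff (mfps_X i * (h :: ('a::comm_ring_1, 'n::finite) mfps)) m =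
    (if 0 < m i then mfps_coeff h (m(i := m i - 1)) else 0)"
  using mfps_coeff_X_power_mult[of i 1 h m] by (auto simp: Suc_le_eq)

section \<open>The filtration by order\<close>

lemma ord_geD: "g \<in> ord_ge n \<Longrightarrow> mdeg m < n \<Longrightarrow> mfps_coeff g m = 0"
  by (simp add: ord_ge_def)

lemma ord_ge_0 [simp]: "ord_ge 0 = UNIV"
  by (simp add: ord_ge_def)

lemma ord_ge_antimono: "m \<le> n \<Longrightarrow> ord_ge n \<subseteq> ord_ge m"
  by (auto simp: ord_ge_def)

lemma ord_ge_mult:
  fixes g h :: "('a::comm_ring_1, 'n::finite) mfps"
  shows "g \<in> ord_ge n \<Longrightarrow> h \<in> ord_ge k \<Longrightarrow> g * h \<in> ord_ge (n + k)"
proof (unfold ord_ge_def, clarify)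
  fix m :: "'n \<Rightarrow> nat"
  assume g: "\<forall>m. mdeg m < n \<longrightarrow> mfps_coeff g m = 0"
    and h: "\<forall>m. mdeg m < k \<longrightarrow> mfps_coeff h m = 0" and m: "mdeg m < n + k"
  show "mfps_coeff (g * h) m = 0"
    unfolding mfps_coeff_mult
  proof (rule sum.neutral, clarify)
    fix a b assume "(a, b) \<in> exponent_splits m"
    then have "mdeg a < n \<or> mdeg b < k"
      using mdeg_splits m by fastforce
    then show "mfps_coeff g a * mfps_coeff h b = 0"
      using g h by auto
  qed
qed

lemma ord_ge_add: "g \<in> ord_ge n \<Longrightarrow> h \<in> ord_ge n \<Longrightarrow> g + h \<in> ord_ge n"
  by (simp add: ord_ge_def)

lemma ord_ge_diff: "g \<in> ord_ge n \<Longrightarrow> h \<in> ord_ge n \<Longrightarrow> g - h \<in> ord_ge n"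
  by (simp add: ord_ge_def)

lemma ord_ge_sum: "(\<And>i. i \<in> A \<Longrightarrow> g i \<in> ord_ge n) \<Longrightarrow> sum g A \<in> ord_ge n"
  by (simp add: ord_ge_def)

lemma ord_ge_multI: "h \<in> ord_ge n \<Longrightarrow> g * h \<in> ord_ge n"
  using ord_ge_mult[of g 0 h n] by simp

lemma ideal_ord_ge: "ideal (ord_ge n) mfps_ring"
  by (auto simp: ideal_type_iff ord_ge_add ord_ge_multI) (simp add: ord_ge_def)

lemma ord_ge_power: "g \<in> ord_ge d \<Longrightarrow> g ^ n \<in> ord_ge (n * d)"
  by (induction n) (auto intro: ord_ge_mult)

lemma monom_in_ord_ge: "mfps_monom b \<in> ord_ge (mdeg b)"
  by (auto simp: ord_ge_def mfps_coeff_monom)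

lemma X_power_in_ord_ge: "mfps_X i ^ k \<in> ord_ge k"
  using monom_in_ord_ge[of "(\<lambda>_. 0)(i := k)"] by (simp add: X_power_eq_monom)

lemma X_in_ord_ge: "mfps_X i \<in> ord_ge 1"
  using X_power_in_ord_ge[of i 1] by simp

text \<open>
  Division with remainder zero by a finite set of monomials: every monomial of the dividend is
  assigned to one chosen divisor, which makes the quotients additive in the dividend.
\<close>
definition monom_quot ::
  "('n::finite \<Rightarrow> nat) set \<Rightarrow> ('a::comm_ring_1, 'n) mfps \<Rightarrow> ('n \<Rightarrow> nat) \<Rightarrow> ('a, 'n) mfps" where
  "monom_quot B g b = Abs_mfps (\<lambda>c.
     if (SOME b'. b' \<in> B \<and> b' \<le> (\<lambda>i. c i + b i)) = b then mfps_coeff g (\<lambda>i. c i + b i) else 0)"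

lemma monom_quot_diff: "monom_quot B (g - h) b = monom_quot B g b - monom_quot B h b"
  by (rule mfps_eqI) (simp add: monom_quot_def)

lemma monom_quot_in_ord_ge: "g \<in> ord_ge n \<Longrightarrow> monom_quot B g b \<in> ord_ge (n - mdeg b)"
  by (auto simp: ord_ge_def monom_quot_def)

lemma monom_quot_eq:
  assumes "finite B" and supp: "\<And>m. mfps_coeff g m \<noteq> 0 \<Longrightarrow> \<exists>b\<in>B. b \<le> m"
  shows "g = (\<Sum>b\<in>B. mfps_monom b * monom_quot B g b)"
proof (rule mfps_eqI)
  fix m
  \<comment> \<open>The divisor assigned to m. It is arbitrary if no element of B divides the
    monomial, but then the coefficient of g at m is zero by \<open>supp\<close>.\<close>
  define s where "s = (SOME b. b \<in> B \<and> b \<le> m)"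
  have "mfps_coeff (mfps_monom b * monom_quot B g b) m =
      (if b = s \<and> b \<le> m then mfps_coeff g m else 0)" for b
  proof (cases "b \<le> m")
    case True
    then have "(\<lambda>i. m i - b i + b i) = m"
      by (auto simp: le_fun_def)
    with True show ?thesis
      by (auto simp: mfps_coeff_monom_mult monom_quot_def s_def)
  qed (simp add: mfps_coeff_monom_mult)
  then have "mfps_coeff (\<Sum>b\<in>B. mfps_monom b * monom_quot B g b) m =
      (\<Sum>b\<in>B. if b = s then (if s \<le> m then mfps_coeff g m else 0) else 0)"
    unfolding mfps_coeff_sum by (intro sum.cong) auto
  also have "\<dots> = (if s \<in> B \<and> s \<le> m then mfps_coeff g m else 0)"
    using assms(1) by simp
  also have "\<dots> = mfps_coeff g m"
  proof (cases "mfps_coeff g m = 0")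
    case False
    then have "s \<in> B \<and> s \<le> m"
      unfolding s_def using someI_ex[of "\<lambda>b. b \<in> B \<and> b \<le> m"] supp[OF False] by blast
    then show ?thesis by simp
  qed simp
  finally show "mfps_coeff g m = mfps_coeff (\<Sum>b\<in>B. mfps_monom b * monom_quot B g b) m" ..
qed

lemma monom_quot_singles_eq:
  fixes g :: "('a::comm_ring_1, 'n::finite) mfps"
  assumes "k > 0" and supp: "\<And>m. mfps_coeff g m \<noteq> 0 \<Longrightarrow> \<exists>i. k \<le> m i"
  shows "g = (\<Sum>i\<in>UNIV. mfps_X i ^ k * monom_quot (range (\<lambda>i. (\<lambda>_. 0)(i := k))) g ((\<lambda>_. 0)(i := k)))"
proof -
  have inj: "inj (\<lambda>i::'n. (\<lambda>_. 0)(i := k))"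
    using assms(1) by (auto intro!: injI dest!: fun_cong split: if_splits)
  have "g = (\<Sum>b\<in>range (\<lambda>i. (\<lambda>_. 0)(i := k)).
      mfps_monom b * monom_quot (range (\<lambda>i. (\<lambda>_. 0)(i := k))) g b)"
    using supp by (intro monom_quot_eq) (auto simp: single_le_iff)
  also have "\<dots> = (\<Sum>i\<in>UNIV. mfps_X i ^ k *
      monom_quot (range (\<lambda>i. (\<lambda>_. 0)(i := k))) g ((\<lambda>_. 0)(i := k)))"
    unfolding sum.reindex[OF inj] by (simp add: X_power_eq_monom)
  finally show ?thesis .
qed

text \<open>The solution is the series g + T g + T (T g) + ...; it converges coefficientwise because
  T is additive and raises the order.\<close>

lemma mfps_fixpoint:
  fixes T :: "('a::comm_ring_1, 'n::finite) mfps \<Rightarrow> ('a, 'n) mfps"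
  assumes T_diff: "\<And>x y. T (x - y) = T x - T y"
    and T_ord: "\<And>x k. x \<in> ord_ge k \<Longrightarrow> T x \<in> ord_ge (Suc k)"
  shows "\<exists>G. G = g + T G"
proof -
  define S where "S k = ((\<lambda>x. g + T x) ^^ k) g" for k
  have S_Suc: "S (Suc k) = g + T (S k)" for k
    by (simp add: S_def)
  have step: "S (Suc k) - S k \<in> ord_ge (Suc k)" for k
  proof (induction k)
    case 0
    show ?case using T_ord[of g 0] by (simp add: S_def)
  next
    case (Suc k)
    have "S (Suc (Suc k)) - S (Suc k) = T (S (Suc k) - S k)"
      by (simp add: S_Suc T_diff)
    with T_ord[OF Suc] show ?case by simp
  qed
  have stable: "mfps_coeff (S k) m = mfps_coeff (S (mdeg m)) m" if "mdeg m \<le> k" for k m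
    using that
  proof (induction k rule: dec_induct)
    case (step n)
    have "mfps_coeff (S (Suc n) - S n) m = 0"
      using \<open>S (Suc n) - S n \<in> ord_ge (Suc n)\<close> step.hyps by (intro ord_geD) auto
    with step.IH show ?case by simp
  qed simp
  \<comment> \<open>From step \<open>mdeg m\<close> on, the coefficient at m no longer
    changes.\<close>
  define G where "G = Abs_mfps (\<lambda>m. mfps_coeff (S (mdeg m)) m)"
  have G: "G - S k \<in> ord_ge (Suc k)" for k
    using stable[of _ k] by (simp add: ord_ge_def G_def less_Suc_eq_le)
  have "G = g + T G"
  proof (rule mfps_eqI)
    fix m :: "'n \<Rightarrow> nat"
    define k where "k = mdeg m"
    have "G - (g + T G) = (G - S (Suc k)) - T (G - S k)"
      by (simp add: T_diff S_Suc)
    also have "\<dots> \<in> ord_ge (Suc (Suc k))"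
      by (intro ord_ge_diff G T_ord)
    finally have "mfps_coeff (G - (g + T G)) m = 0"
      by (rule ord_geD) (simp add: k_def)
    then show "mfps_coeff G m = mfps_coeff (g + T G) m"
      by simp
  qed
  then show ?thesis ..
qed

text \<open>Scaling the constant term to 1 turns b into 1 - h with h of positive order, and the
  fixed point G = 1 + h G inverts 1 - h.\<close>

lemma mfps_unit:
  fixes b :: "('a::field, 'n::finite) mfps"
  assumes "b \<notin> ord_ge 1"
  shows "\<exists>c. b * c = 1"
proof -
  define u where "u = mfps_coeff b (\<lambda>_. 0)"
  have u: "u \<noteq> 0"
    using assms by (auto simp: ord_ge_def u_def mdeg_eq_0_iff)
  define h where "h = 1 - mfps_const (1 / u) * b"
  have h: "h \<in> ord_ge 1"
    using u by (auto simp: ord_ge_def h_def mdeg_eq_0_iff mfps_coeff_const_mult u_def)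
  have "\<exists>G. G = 1 + h * G"
    by (rule mfps_fixpoint) (use ord_ge_mult[OF h] in \<open>auto simp: right_diff_distrib\<close>)
  then obtain G where "G = 1 + h * G" ..
  then have "b * (mfps_const (1 / u) * G) = 1"
    by (simp add: h_def algebra_simps)
  then show ?thesis ..
qed


section \<open>Powers of the maximal ideal\<close>

text \<open>Only a constant term fails to be divisible by a variable, and division by a variable
  lowers the order by just one. This drives the induction over the powers of the maximal
  ideal.\<close>

lemma range_X_quot:
  assumes "g \<in> ord_ge (Suc n)"
  shows "\<exists>h. (\<forall>i. h i \<in> ord_ge n) \<and> g = (\<Sum>i\<in>UNIV. h i * mfps_X i)"
proof (intro exI conjI allI)
  let ?h = "\<lambda>i. monom_quot (range (\<lambda>i. (\<lambda>_. 0)(i := Suc 0))) g ((\<lambda>_. 0)(i := Suc 0))"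
  show "?h i \<in> ord_ge n" for i
    using monom_quot_in_ord_ge[OF assms, of _ "(\<lambda>_. 0)(i := Suc 0)"] by simp
  have "\<exists>i. Suc 0 \<le> m i" if "mfps_coeff g m \<noteq> 0" for m
  proof (rule ccontr)
    assume "\<not> ?thesis"
    then have "m = (\<lambda>_. 0)" by (auto simp: Suc_le_eq)
    with that assms show False by (simp add: ord_ge_def)
  qed
  from monom_quot_singles_eq[of "Suc 0" g, OF _ this]
  show "g = (\<Sum>i\<in>UNIV. ?h i * mfps_X i)"
    by (simp add: mult.commute)
qed

lemma max_ideal_eq: "mfps_max_ideal = (ord_ge 1 :: ('a::field, 'n::finite) mfps set)"
proof -
  have "(\<Sum>i\<in>UNIV. c i * mfps_X i) \<in> ord_ge 1" for c :: "'n \<Rightarrow> ('a, 'n) mfps"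
    by (intro ord_ge_sum ord_ge_multI X_in_ord_ge)
  then show ?thesis
    using range_X_quot[of _ 0] by (auto simp: mfps_max_ideal_def genideal_range_type)
qed

lemma max_ideal_power_eq:
  "ideal_power mfps_ring mfps_max_ideal n = (ord_ge n :: ('a::field, 'n::finite) mfps set)"
proof (induction n)
  case (Suc n)
  show ?case
  proof (intro equalityI subsetI)
    fix g :: "('a, 'n) mfps"
    assume "g \<in> ideal_power mfps_ring mfps_max_ideal (Suc n)"
    then show "g \<in> ord_ge (Suc n)"
      unfolding ideal_power_Suc
    proof (induction rule: ideal_prod.induct)
      case (prod i j)
      then have "i \<in> ord_ge n" "j \<in> ord_ge 1"
        using Suc.IH max_ideal_eq by auto
      then show ?case
        using ord_ge_mult[of i n j 1] by simp
    qed (simp add: ord_ge_add)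
  next
    fix g :: "('a, 'n) mfps"
    assume "g \<in> ord_ge (Suc n)"
    then obtain h where h: "\<And>i. h i \<in> ord_ge n" "g = (\<Sum>i\<in>UNIV. h i * mfps_X i)"
      using range_X_quot by blast
    have "h i \<otimes>\<^bsub>mfps_ring\<^esub> mfps_X i \<in> ideal_power mfps_ring mfps_max_ideal (Suc n)" for i
      unfolding ideal_power_Suc Suc.IH
      by (rule ideal_prod.prod) (use h X_in_ord_ge in \<open>auto simp: max_ideal_eq\<close>)
    then show "g \<in> ideal_power mfps_ring mfps_max_ideal (Suc n)"
      unfolding h(2) by (intro ideal_type_sum ideal_ideal_power) (auto simp: max_ideal_eq ideal_ord_ge)
  qed
qed simp

text \<open>
  Let \<open>a\<close> have maximal Euclidean norm among the exponents of the initial form of \<open>r\<close>. Then the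
  linear functional \<open>b \<mapsto> \<langle>a, b\<rangle>\<close> attains its maximum over these exponents only at \<open>a\<close>, so the
  exponent \<open>n a\<close> arises in the initial form of \<open>r ^ n\<close> in a single way.
\<close>
lemma power_extreme_coeff:
  fixes r :: "('a::comm_ring_1, 'n::finite) mfps"
  assumes r: "r \<in> ord_ge d" and a: "mdeg a = d"
    and max: "\<And>b. mdeg b = d \<Longrightarrow> mfps_coeff r b \<noteq> 0 \<Longrightarrow> (\<Sum>i\<in>UNIV. b i * b i) \<le> (\<Sum>i\<in>UNIV. a i * a i)"
  shows "mfps_coeff (r ^ n) (\<lambda>i. n * a i) = mfps_coeff r a ^ n"
proof -
  define w where "w b = (\<Sum>i\<in>UNIV. a i * b i)" for b
  have w_add: "w m = w b + w c" if "(b, c) \<in> exponent_splits m" for b c m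
  proof -
    have "m = (\<lambda>i. b i + c i)"
      using that by (auto simp: exponent_splits_def)
    then show ?thesis
      by (simp add: w_def distrib_left sum.distrib)
  qed
  have w_max: "w b \<le> w a \<and> (w b = w a \<longrightarrow> b = a)" if b: "mdeg b = d" "mfps_coeff r b \<noteq> 0" for b
  proof -
    \<comment> \<open>The identity |a - b|^2 = |a|^2 + |b|^2 - 2 <a, b>. With |b| <= |a| and w a =
      |a|^2 it bounds |a - b|^2 by 2 (w a - w b). Integers avoid truncated subtraction.\<close>
    have "(\<Sum>i\<in>UNIV. (int (a i) - int (b i))\<^sup>2)
        = int (\<Sum>i\<in>UNIV. a i * a i) + int (\<Sum>i\<in>UNIV. b i * b i) - 2 * int (w b)"
      by (simp add: w_def power2_eq_square algebra_simps sum.distrib sum_subtractf sum_distrib_left)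
    then have le: "(\<Sum>i\<in>UNIV. (int (a i) - int (b i))\<^sup>2) \<le> 2 * int (w a) - 2 * int (w b)"
      using max[OF b, folded of_nat_le_iff[where 'a = int]] by (simp only: w_def)
    moreover have nonneg: "0 \<le> (\<Sum>i\<in>UNIV. (int (a i) - int (b i))\<^sup>2)"
      by (intro sum_nonneg) simp
    ultimately have "w b \<le> w a" by linarith
    moreover have "b = a" if "w b = w a"
    proof -
      have "(\<Sum>i\<in>UNIV. (int (a i) - int (b i))\<^sup>2) = 0"
        using le nonneg that by linarith
      then show ?thesis
        by (subst (asm) sum_nonneg_eq_0_iff) (auto simp: fun_eq_iff)
    qed
    ultimately show ?thesis by blast
  qed
  have ord: "r ^ n \<in> ord_ge (n * d)" for n
    by (rule ord_ge_power[OF r])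
  have w_mult: "w (\<lambda>i. n * a i) = n * w a" for n
    by (simp add: w_def sum_distrib_left mult.left_commute)
  \<comment> \<open>The induction has to carry along that, among the exponents of degree n d
    occurring in r^n, w is at most n w a, with equality only at n a.\<close>
  have "(\<forall>b. mdeg b = n * d \<longrightarrow> mfps_coeff (r ^ n) b \<noteq> 0 \<longrightarrow>
            w b \<le> n * w a \<and> (w b = n * w a \<longrightarrow> b = (\<lambda>i. n * a i)))
        \<and> mfps_coeff (r ^ n) (\<lambda>i. n * a i) = mfps_coeff r a ^ n"
  proof (induction n)
    case 0
    show ?case by (auto simp: mdeg_eq_0_iff w_def)
  next
    case (Suc n)
    have factors: "mdeg b = d \<and> mdeg c = n * d"
      if "(b, c) \<in> exponent_splits m" "mdeg m = Suc n * d"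
        "mfps_coeff r b \<noteq> 0" "mfps_coeff (r ^ n) c \<noteq> 0" for b c m
      using ord_geD[OF r, of b] ord_geD[OF ord, of c n] mdeg_splits[OF that(1)] that
      by (cases "mdeg b < d"; cases "mdeg c < n * d") auto
    have split: "w m \<le> Suc n * w a \<and> (w m = Suc n * w a \<longrightarrow> b = a \<and> c = (\<lambda>i. n * a i))"
      if "(b, c) \<in> exponent_splits m" "mdeg m = Suc n * d"
        "mfps_coeff r b \<noteq> 0" "mfps_coeff (r ^ n) c \<noteq> 0" for b c m
    proof -
      have "mdeg b = d" "mdeg c = n * d"
        using factors[OF that] by auto
      then have b: "w b \<le> w a" "w b = w a \<longrightarrow> b = a"
        and c: "w c \<le> n * w a" "w c = n * w a \<longrightarrow> c = (\<lambda>i. n * a i)"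
        using w_max[of b] Suc.IH that by auto
      show ?thesis
        using b c w_add[OF that(1)] by (cases "w b = w a") auto
    qed
    show ?case
    proof (rule conjI, intro allI impI)
      fix m assume m: "mdeg m = Suc n * d" and nz: "mfps_coeff (r ^ Suc n) m \<noteq> 0"
      from nz obtain b c where bc: "(b, c) \<in> exponent_splits m"
        "mfps_coeff r b \<noteq> 0" "mfps_coeff (r ^ n) c \<noteq> 0"
        unfolding power_Suc mfps_coeff_mult
        by (elim sum.not_neutral_contains_not_neutral) (auto dest: mult_not_zero)
      from split[OF bc(1) m bc(2,3)]
      show "w m \<le> Suc n * w a \<and> (w m = Suc n * w a \<longrightarrow> m = (\<lambda>i. Suc n * a i))"
        using bc(1) by (auto simp: exponent_splits_def fun_eq_iff)
    next
      let ?m = "\<lambda>i. Suc n * a i"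
      have m: "mdeg ?m = Suc n * d"
        using a by (simp add: mdeg_def flip: sum_distrib_left)
      have "mfps_coeff (r ^ Suc n) ?m =
          (\<Sum>(b, c)\<in>{(a, \<lambda>i. n * a i)}. mfps_coeff r b * mfps_coeff (r ^ n) c)"
        unfolding power_Suc mfps_coeff_mult
      proof (rule sum.mono_neutral_right)
        show "\<forall>p\<in>exponent_splits ?m - {(a, \<lambda>i. n * a i)}.
            (case p of (b, c) \<Rightarrow> mfps_coeff r b * mfps_coeff (r ^ n) c) = 0"
        proof
          fix p assume p: "p \<in> exponent_splits ?m - {(a, \<lambda>i. n * a i)}"
          obtain b c where bc: "p = (b, c)"
            by (cases p)
          have "mfps_coeff r b = 0 \<or> mfps_coeff (r ^ n) c = 0"
          proof (rule ccontr)
            assume "\<not> ?thesis"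
            with split[of b c ?m, OF _ m] p w_mult[of "Suc n"] show False
              unfolding bc by blast
          qed
          then show "(case p of (b, c) \<Rightarrow> mfps_coeff r b * mfps_coeff (r ^ n) c) = 0"
            unfolding bc by auto
        qed
        show "{(a, \<lambda>i. n * a i)} \<subseteq> exponent_splits ?m"
          by (simp add: exponent_splits_def)
      qed simp
      then show "mfps_coeff (r ^ Suc n) ?m = mfps_coeff r a ^ Suc n"
        using Suc.IH by simp
    qed
  qed
  then show ?thesis by blast
qed

lemma finite_mdeg_eq: "finite {m :: 'n::finite \<Rightarrow> nat. mdeg m = d}"
proof (rule finite_subset)
  have "m i \<le> mdeg m" for m :: "'n \<Rightarrow> nat" and i
    unfolding mdeg_def by (rule member_le_sum) auto
  then show "{m :: 'n \<Rightarrow> nat. mdeg m = d} \<subseteq> PiE UNIV (\<lambda>_. {..d})"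
    by auto
qed (intro finite_PiE, auto)

lemma not_ord_ge_least:
  assumes "r \<notin> ord_ge k"
  obtains d a where "d < k" "r \<in> ord_ge d" "mdeg a = d" "mfps_coeff r a \<noteq> 0"
proof -
  let ?P = "\<lambda>d. \<exists>a. mdeg a = d \<and> mfps_coeff r a \<noteq> 0"
  obtain d where d: "d < k" "?P d"
    using assms by (auto simp: ord_ge_def)
  define e where "e = (LEAST d. ?P d)"
  have "?P e" "e \<le> d"
    unfolding e_def using LeastI[of ?P, OF d(2)] Least_le[of ?P, OF d(2)] by auto
  moreover have "r \<in> ord_ge e"
    unfolding e_def ord_ge_def using not_less_Least[of _ ?P] by blast
  ultimately show ?thesis
    using that d by (metis le_less_trans)
qed

text \<open>If r had order d < k, then c_i r^(n - i) would have order at least i k + (n - i) d > n d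
  for every i >= 1. Such terms cannot cancel the coefficient of r^n in degree n d that is nonzero by
  \<open>power_extreme_coeff\<close>.\<close>

lemma integral_closure_subset_ord_ge:
  fixes I :: "('a::field, 'n::finite) mfps set"
  assumes I: "I \<subseteq> ord_ge k"
  shows "integral_closure mfps_ring I \<subseteq> ord_ge k"
proof
  fix r assume "r \<in> integral_closure mfps_ring I"
  then have "\<exists>n c. n \<ge> 1 \<and> (\<forall>i\<in>{1..n}. c i \<in> ideal_power mfps_ring I i) \<and>
      r ^ n + (\<Sum>i\<in>{1..n}. c i * r ^ (n - i)) = 0"
    by (simp add: integral_closure_def)
  then obtain n c where n: "n \<ge> 1" and c: "\<And>i. i \<in> {1..n} \<Longrightarrow> c i \<in> ideal_power mfps_ring I i"
    and eq: "r ^ n + (\<Sum>i\<in>{1..n}. c i * r ^ (n - i)) = 0"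
    by blast
  show "r \<in> ord_ge k"
  proof (rule ccontr)
    assume "r \<notin> ord_ge k"
    then obtain d a0 where d: "d < k" "r \<in> ord_ge d" "mdeg a0 = d" "mfps_coeff r a0 \<noteq> 0"
      by (rule not_ord_ge_least)
    define A where "A = {b. mdeg b = d \<and> mfps_coeff r b \<noteq> 0}"
    have "finite A" "A \<noteq> {}"
      using d finite_mdeg_eq[of d] by (auto simp: A_def)
    define N where "N b = (\<Sum>i\<in>UNIV. b i * b i)" for b :: "'n \<Rightarrow> nat"
    have "Max (N ` A) \<in> N ` A"
      using \<open>finite A\<close> \<open>A \<noteq> {}\<close> by (intro Max_in) auto
    then obtain a where a: "a \<in> A" and "N a = Max (N ` A)"
      by auto
    then have max: "N b \<le> N a" if "b \<in> A" for b
      using that \<open>finite A\<close> by simp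
    let ?m = "\<lambda>i. n * a i"
    have m: "mdeg ?m = n * d"
      using a by (simp add: A_def mdeg_def flip: sum_distrib_left)
    have "mfps_coeff (c i * r ^ (n - i)) ?m = 0" if i: "i \<in> {1..n}" for i
    proof (rule ord_geD)
      have powers: "ideal_power mfps_ring (ord_ge k :: ('a, 'n) mfps set) i \<subseteq> ord_ge (i * k)" for i
      proof (induction i)
        case (Suc i)
        show ?case
        proof
          fix x :: "('a, 'n) mfps" assume "x \<in> ideal_power mfps_ring (ord_ge k) (Suc i)"
          then show "x \<in> ord_ge (Suc i * k)"
            unfolding ideal_power_Suc
          proof (induction rule: ideal_prod.induct)
            case (prod y z)
            then show ?case
              using Suc ord_ge_mult[of y "i * k" z k] by (auto simp: add.commute)
          qed (simp add: ord_ge_add)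
        qed
      qed simp
      have "c i \<in> ord_ge (i * k)"
        using c[OF i] ideal_power_subset[OF I] powers by blast
      then show "c i * r ^ (n - i) \<in> ord_ge (i * k + (n - i) * d)"
        by (intro ord_ge_mult ord_ge_power d)
      have "n * d = i * d + (n - i) * d"
        using i by (simp flip: add_mult_distrib)
      also have "\<dots> < i * k + (n - i) * d"
        using i d by simp
      finally show "mdeg ?m < i * k + (n - i) * d"
        by (simp add: m)
    qed
    then have "mfps_coeff (r ^ n) ?m = mfps_coeff (r ^ n + (\<Sum>i\<in>{1..n}. c i * r ^ (n - i))) ?m"
      by simp
    then have "mfps_coeff (r ^ n) ?m = 0"
      unfolding eq by simp
    moreover have "mfps_coeff (r ^ n) ?m = mfps_coeff r a ^ n"
      by (rule power_extreme_coeff[of r d]) (use d a max in \<open>auto simp: A_def N_def\<close>)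
    moreover have "mfps_coeff r a ^ n \<noteq> 0"
      using a by (simp add: A_def)
    ultimately show False
      by simp
  qed
qed

section \<open>The Jacobian ideal\<close>

lemma pderiv_simps [simp]:
  "mfps_pderiv j (g + h) = mfps_pderiv j g + mfps_pderiv j h"
  "mfps_pderiv j (sum s A) = (\<Sum>i\<in>A. mfps_pderiv j (s i))"
  "mfps_pderiv j (mfps_const c * g) = mfps_const c * mfps_pderiv j g"
proof -
  show add: "mfps_pderiv j (g + h) = mfps_pderiv j g + mfps_pderiv j h" for g h
    by (rule mfps_eqI) (simp add: mfps_pderiv.rep_eq algebra_simps)
  have "mfps_pderiv j 0 = 0"
    by (rule mfps_eqI) (simp add: mfps_pderiv.rep_eq)
  then show "mfps_pderiv j (sum s A) = (\<Sum>i\<in>A. mfps_pderiv j (s i))"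
    by (induction A rule: infinite_finite_induct) (simp_all add: add)
  show "mfps_pderiv j (mfps_const c * g) = mfps_const c * mfps_pderiv j g"
    by (rule mfps_eqI) (simp add: mfps_pderiv.rep_eq mfps_coeff_const_mult mult.left_commute)
qed

text \<open>The case of the Leibniz rule from which both power rules below follow by induction,
  since the powers of a variable and of the sum of the variables arise by multiplying with
  variables.\<close>

lemma pderiv_X_mult:
  fixes h :: "('a::comm_ring_1, 'n::finite) mfps"
  shows "mfps_pderiv j (mfps_X i * h) = (if i = j then h else 0) + mfps_X i * mfps_pderiv j h"
proof (rule mfps_eqI)
  fix m :: "'n \<Rightarrow> nat"
  show "mfps_coeff (mfps_pderiv j (mfps_X i * h)) m =
      mfps_coeff ((if i = j then h else 0) + mfps_X i * mfps_pderiv j h) m"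
  proof (cases "i = j")
    case True
    then show ?thesis
      by (cases "m j") (auto simp: mfps_pderiv.rep_eq mfps_coeff_X_mult distrib_right add.commute fun_upd_idem)
  next
    case False
    then show ?thesis
      by (auto simp: mfps_pderiv.rep_eq mfps_coeff_X_mult fun_upd_twist)
  qed
qed

lemma pderiv_X_power:
  "mfps_pderiv j (mfps_X i ^ Suc n :: ('a::comm_ring_1, 'n::finite) mfps) =
    (if i = j then of_nat (Suc n) * mfps_X i ^ n else 0)"
proof (induction n)
  case 0
  have "mfps_pderiv j (1 :: ('a, 'n) mfps) = 0"
    by (rule mfps_eqI) (auto simp: mfps_pderiv.rep_eq fun_eq_iff)
  then show ?case
    using pderiv_X_mult[of j i "1 :: ('a, 'n) mfps"] by simp
next
  case (Suc n)
  then show ?case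
    unfolding power_Suc[of _ "Suc n"] pderiv_X_mult by (auto simp: algebra_simps)
qed

lemma pderiv_sum_X_power:
  "mfps_pderiv j ((\<Sum>i\<in>UNIV. mfps_X i) ^ Suc n :: ('a::comm_ring_1, 'n::finite) mfps) =
    of_nat (Suc n) * (\<Sum>i\<in>UNIV. mfps_X i) ^ n"
proof -
  let ?l = "(\<Sum>i\<in>UNIV. mfps_X i) :: ('a, 'n) mfps"
  have mult: "mfps_pderiv j (?l * h) = h + ?l * mfps_pderiv j h" for h
    by (simp add: sum_distrib_right pderiv_X_mult sum.distrib)
  have one: "mfps_pderiv j (1 :: ('a, 'n) mfps) = 0"
    by (rule mfps_eqI) (auto simp: mfps_pderiv.rep_eq fun_eq_iff)
  show ?thesis
  proof (induction n)
    case 0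
    show ?case using mult[of "1 :: ('a, 'n) mfps"] one by simp
  next
    case (Suc n)
    then show ?case
      unfolding power_Suc[of _ "Suc n"] mult by (simp add: algebra_simps)
  qed
qed

lemma mfps_of_nat_const: "of_nat k = (mfps_const (of_nat k) :: ('a::comm_ring_1, 'n::finite) mfps)"
proof (rule mfps_eqI)
  fix m :: "'n \<Rightarrow> nat"
  show "mfps_coeff (of_nat k) m = mfps_coeff (mfps_const (of_nat k) :: ('a, 'n) mfps) m"
    by (induction k) (auto simp: mfps_const.rep_eq)
qed

lemma mfps_const_mult: "mfps_const c * mfps_const d = (mfps_const (c * d) :: ('a::comm_ring_1, 'n::finite) mfps)"
  by (rule mfps_eqI) (simp add: mfps_coeff_const_mult mfps_const.rep_eq)

lemma mfps_const_1: "mfps_const 1 = (1 :: ('a::comm_ring_1, 'n::finite) mfps)"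
  by (rule mfps_eqI) (simp add: mfps_const.rep_eq)

section \<open>The generators of the Jacobian ideal of f\<close>

abbreviation lin :: "(rat, 5) mfps" where
  "lin \<equiv> \<Sum>i\<in>UNIV. mfps_X i"

definition jac_gen :: "5 \<Rightarrow> (rat, 5) mfps" where
  "jac_gen i = mfps_X i ^ 3 + 5 * lin ^ 4"

text \<open>Cancels the factor 1/4 in f, both against the 4 from differentiating fourth powers and
  in Euler's relation.\<close>

lemma const_quarter: "4 * mfps_const (1 / 4) = (1 :: (rat, 5) mfps)"
proof -
  have four: "(4 :: (rat, 5) mfps) = mfps_const 4"
    using mfps_of_nat_const[of 4, where 'a = rat and 'n = 5] by simp
  show ?thesis
    by (subst four) (simp add: mfps_const_mult mfps_const_1)
qed

lemma pderiv_eq_jac_gen: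
  "mfps_pderiv i (mfps_const (1 / 4) * (\<Sum>i\<in>UNIV. mfps_X i ^ 4) + lin ^ 5) = jac_gen i"
proof -
  have "mfps_pderiv i (mfps_X j ^ 4 :: (rat, 5) mfps) = (if j = i then 4 * mfps_X i ^ 3 else 0)" for j
    using pderiv_X_power[of i j 3, where 'a = rat] by simp
  then have "mfps_pderiv i (\<Sum>i\<in>UNIV. mfps_X i ^ 4 :: (rat, 5) mfps) = 4 * mfps_X i ^ 3"
    by simp
  moreover have "mfps_pderiv i (lin ^ 5) = 5 * lin ^ 4"
    using pderiv_sum_X_power[of i 4, where 'a = rat] by simp
  moreover have "mfps_const (1 / 4) * (4 * mfps_X i ^ 3) = (4 * mfps_const (1 / 4)) * (mfps_X i ^ 3 :: (rat, 5) mfps)"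
    by (simp only: mult_ac)
  ultimately show ?thesis
    by (simp only: pderiv_simps(1,3) const_quarter jac_gen_def mult_1)
qed

lemma lin_in_ord_ge: "lin \<in> ord_ge 1"
  by (intro ord_ge_sum X_in_ord_ge)

lemma lin_power_in_ord_ge: "lin ^ n \<in> ord_ge n"
  using ord_ge_power[OF lin_in_ord_ge, of n] by simp

lemma jac_gen_in_ord_ge: "jac_gen i \<in> ord_ge 3"
  unfolding jac_gen_def
  using X_power_in_ord_ge[of i 3] lin_power_in_ord_ge[of 4] ord_ge_antimono[of 3 4]
  by (intro ord_ge_add ord_ge_multI) auto

text \<open>
  Each monomial of degree at least 11 is divisible by some \<open>x\<^sub>i\<^sup>3\<close>. Replacing \<open>x\<^sub>i\<^sup>3\<close> by the
  generator \<open>x\<^sub>i\<^sup>3 + 5 \<ell>\<^sup>4\<close> costs an error of higher order, which is absorbed by a fixed point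
  in place of Nakayama's lemma.
\<close>
lemma ord_ge_11_quot:
  assumes g: "g \<in> ord_ge 11"
  shows "\<exists>h. (\<forall>i. h i \<in> ord_ge 8) \<and> g = (\<Sum>i\<in>UNIV. h i * jac_gen i)"
proof -
  define q :: "(rat, 5) mfps \<Rightarrow> 5 \<Rightarrow> (rat, 5) mfps"
    where "q x i = monom_quot (range (\<lambda>i. (\<lambda>_. 0)(i := 3))) x ((\<lambda>_. 0)(i := 3))" for x i
  \<comment> \<open>Once G is divisible by the cubes, G = g + T G rewrites g = G - T G as the sum of
    the \<open>q G i\<close> times x_i^3 + 5 \<open>lin\<close>^4.\<close>
  define T where "T x = - (5 * lin ^ 4 * (\<Sum>i\<in>UNIV. q x i))" for x
  have q_ord: "q x i \<in> ord_ge (k - 3)" if "x \<in> ord_ge k" for x i k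
    using monom_quot_in_ord_ge[OF that, of _ "(\<lambda>_. 0)(i := 3)"] by (simp add: q_def)
  have T_ord: "T x \<in> ord_ge (Suc k)" if "x \<in> ord_ge k" for x k
  proof -
    have "lin ^ 4 * (\<Sum>i\<in>UNIV. q x i) \<in> ord_ge (4 + (k - 3))"
      by (intro ord_ge_mult lin_power_in_ord_ge ord_ge_sum q_ord that)
    moreover have "ord_ge (4 + (k - 3)) \<subseteq> (ord_ge (Suc k) :: (rat, 5) mfps set)"
      by (rule ord_ge_antimono) simp
    ultimately have "(-5) * (lin ^ 4 * (\<Sum>i\<in>UNIV. q x i)) \<in> ord_ge (Suc k)"
      by (intro ord_ge_multI[of "lin ^ 4 * _"]) auto
    then show ?thesis
      by (simp add: T_def mult.assoc)
  qed
  have "\<exists>G. G = g + T G"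
  proof (rule mfps_fixpoint)
    show "T (x - y) = T x - T y" for x y
      by (simp add: T_def q_def monom_quot_diff sum_subtractf right_diff_distrib)
  qed (rule T_ord)
  then obtain G where G: "G = g + T G" ..
  \<comment> \<open>T G has one order more than G, so the order of G can be raised step by step up
    to that of g.\<close>
  have "G \<in> ord_ge n" if "n \<le> 11" for n
    using that
  proof (induction n)
    case (Suc n)
    then have "T G \<in> ord_ge (Suc n)"
      by (intro T_ord) simp
    moreover have "g \<in> ord_ge (Suc n)"
      using g ord_ge_antimono[OF Suc.prems] by blast
    ultimately show ?case
      by (subst G) (rule ord_ge_add)
  qed simp
  then have G_ord: "G \<in> ord_ge 11" by simp
  \<comment> \<open>Pigeonhole: five exponents of size at most 2 give degree at most 10.\<close>
  have "\<exists>i. 3 \<le> m i" if "mfps_coeff G m \<noteq> 0" for m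
  proof (rule ccontr)
    assume "\<not> ?thesis"
    then have "\<not> 3 \<le> m i" for i
      by blast
    then have "m i \<le> 2" for i
      by (simp add: not_le less_Suc_eq_le numeral_3_eq_3 numeral_2_eq_2)
    then have "mdeg m \<le> (\<Sum>i\<in>(UNIV :: 5 set). 2)"
      unfolding mdeg_def by (intro sum_mono)
    then show False
      using that G_ord by (simp add: ord_ge_def)
  qed
  then have "G = (\<Sum>i\<in>UNIV. mfps_X i ^ 3 * q G i)"
    unfolding q_def by (intro monom_quot_singles_eq) auto
  moreover have "g = G - T G"
    using G by (metis add_diff_cancel_right')
  ultimately have "g = (\<Sum>i\<in>UNIV. mfps_X i ^ 3 * q G i) + 5 * lin ^ 4 * (\<Sum>i\<in>UNIV. q G i)"
    by (simp add: T_def)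
  also have "\<dots> = (\<Sum>i\<in>UNIV. q G i * jac_gen i)"
    unfolding sum_distrib_left jac_gen_def by (simp add: algebra_simps flip: sum.distrib)
  finally show ?thesis
    using q_ord[OF G_ord] by (intro exI[of _ "q G"]) simp
qed

section \<open>Integral closure and radical of the Jacobian ideal\<close>

abbreviation jac_ideal :: "(rat, 5) mfps set" where
  "jac_ideal \<equiv> Idl\<^bsub>mfps_ring\<^esub> (range jac_gen)"

lemma jac_ideal_eq: "jac_ideal = {\<Sum>i\<in>UNIV. c i * jac_gen i |c. True}"
  by (rule genideal_range_type)

lemma ideal_jac_ideal: "ideal jac_ideal mfps_ring"
  by (intro ring.genideal_ideal cring.axioms(1) cring_type) simp

lemma jac_gen_in_jac_ideal: "jac_gen i \<in> jac_ideal"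
  using ring.genideal_self[OF cring.axioms(1)[OF cring_type], of "range jac_gen"] by auto

lemma jac_ideal_subset: "jac_ideal \<subseteq> ord_ge 3"
proof
  fix g assume "g \<in> jac_ideal"
  then obtain c where "g = (\<Sum>i\<in>UNIV. c i * jac_gen i)"
    unfolding jac_ideal_eq by blast
  then show "g \<in> ord_ge 3"
    by (simp add: ord_ge_sum ord_ge_multI jac_gen_in_ord_ge)
qed

lemma ord_ge_11_subset_jac_ideal: "ord_ge 11 \<subseteq> jac_ideal"
  using ord_ge_11_quot unfolding jac_ideal_eq by blast

text \<open>Multiplication by r sends each monomial of degree 8 to order at least 11, where
  \<open>ord_ge_11_quot\<close> applies. Expanding the quotients along the monomials of degree 8
  again gives a matrix over J for the determinant trick.\<close>

lemma ord_ge_3_subset_integral_closure: "ord_ge 3 \<subseteq> integral_closure mfps_ring jac_ideal"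
proof
  fix r :: "(rat, 5) mfps" assume r: "r \<in> ord_ge 3"
  define V where "V = {b :: 5 \<Rightarrow> nat. mdeg b = 8}"
  have V: "finite V"
    unfolding V_def by (rule finite_mdeg_eq)
  have le_ex: "\<exists>b\<in>V. b \<le> m" if "8 \<le> mdeg m" for m :: "5 \<Rightarrow> nat"
    using that
  proof (induction "mdeg m" arbitrary: m rule: less_induct)
    case less
    show ?case
    proof (cases "mdeg m = 8")
      case True
      then show ?thesis by (auto simp: V_def)
    next
      case False
      obtain i where i: "m i > 0"
        using less.prems mdeg_eq_0_iff[of m] by fastforce
      let ?m = "m(i := m i - 1)"
      have "m = (\<lambda>j. ?m j + ((\<lambda>_. 0)(i := 1)) j)"
        using i by auto
      then have "mdeg m = mdeg ?m + 1"
        by (metis mdeg_add mdeg_single)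
      then obtain b where "b \<in> V" "b \<le> ?m"
        using less False by fastforce
      moreover have "?m \<le> m"
        by (simp add: le_fun_def)
      ultimately show ?thesis
        using order_trans by blast
    qed
  qed
  have "\<exists>C. (\<forall>b'\<in>V. C b' \<in> jac_ideal) \<and> r * mfps_monom b = (\<Sum>b'\<in>V. C b' * mfps_monom b')"
    if b: "b \<in> V" for b
  proof -
    have "r * mfps_monom b \<in> ord_ge (3 + 8)"
      using b monom_in_ord_ge[of b] by (intro ord_ge_mult r) (simp add: V_def)
    then obtain h where h: "\<And>i. h i \<in> ord_ge 8" "r * mfps_monom b = (\<Sum>i\<in>UNIV. h i * jac_gen i)"
      using ord_ge_11_quot by auto
    define C where "C b' = (\<Sum>i\<in>UNIV. monom_quot V (h i) b' * jac_gen i)" for b'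
    have "h i = (\<Sum>b'\<in>V. mfps_monom b' * monom_quot V (h i) b')" for i
      by (rule monom_quot_eq[OF V]) (metis h(1) le_ex linorder_not_le ord_geD)
    then have "r * mfps_monom b = (\<Sum>i\<in>UNIV. (\<Sum>b'\<in>V. mfps_monom b' * monom_quot V (h i) b') * jac_gen i)"
      using h(2) by simp
    also have "\<dots> = (\<Sum>i\<in>UNIV. \<Sum>b'\<in>V. monom_quot V (h i) b' * jac_gen i * mfps_monom b')"
      unfolding sum_distrib_right by (simp add: mult_ac)
    also have "\<dots> = (\<Sum>b'\<in>V. C b' * mfps_monom b')"
      unfolding C_def sum_distrib_right by (rule sum.swap)
    finally have "r * mfps_monom b = (\<Sum>b'\<in>V. C b' * mfps_monom b')" .
    moreover have "C b' \<in> jac_ideal" for b'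
      unfolding C_def jac_ideal_eq by (auto intro!: exI[of _ "\<lambda>i. monom_quot V (h i) b'"])
    ultimately show ?thesis by blast
  qed
  then have "\<forall>b\<in>V. \<exists>C. (\<forall>b'\<in>V. C b' \<in> jac_ideal) \<and>
      r * mfps_monom b = (\<Sum>b'\<in>V. C b' * mfps_monom b')"
    by blast
  from bchoice[OF this] obtain C where C: "\<And>b b'. b \<in> V \<Longrightarrow> b' \<in> V \<Longrightarrow> C b b' \<in> jac_ideal"
    "\<And>b. b \<in> V \<Longrightarrow> r * mfps_monom b = (\<Sum>b'\<in>V. C b b' * mfps_monom b')"
    by blast
  \<comment> \<open>The eighth power of a variable; any monomial of degree 8 would serve as the
    regular element.\<close>
  obtain b0 where "b0 \<in> V"
    using mdeg_single[of "0 :: 5" 8] unfolding V_def by blast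
  then show "r \<in> integral_closure mfps_ring jac_ideal"
    using integral_closure_determinant_trick[OF ideal_jac_ideal V, of C r mfps_monom b0] C
      monom_mult_eq_0D by blast
qed

lemma integral_closure_jac_ideal: "integral_closure mfps_ring jac_ideal = ord_ge 3"
  using ord_ge_3_subset_integral_closure integral_closure_subset_ord_ge[OF jac_ideal_subset] by blast

text \<open>A series with nonzero constant term is a unit, and no power of a unit has order 3 or
  more. Conversely, the 11th power of a series of positive order has order at least 11.\<close>

lemma radical_jac_ideal: "radical mfps_ring jac_ideal = ord_ge 1"
proof (intro equalityI subsetI)
  fix r assume "r \<in> radical mfps_ring jac_ideal"
  then obtain n where n: "r ^ n \<in> ord_ge 3"
    using jac_ideal_subset by (auto simp: radical_def)
  show "r \<in> ord_ge 1"
  proof (rule ccontr)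
    assume "r \<notin> ord_ge 1"
    then obtain c where "r * c = 1"
      using mfps_unit by blast
    then have "c ^ n * r ^ n = 1"
      by (metis mult.commute power_mult_distrib power_one)
    then have "1 \<in> (ord_ge 3 :: (rat, 5) mfps set)"
      using ord_ge_multI[OF n, of "c ^ n"] by simp
    then show False
      by (auto simp: ord_ge_def dest!: spec[of _ "\<lambda>_. 0"])
  qed
next
  fix r :: "(rat, 5) mfps" assume "r \<in> ord_ge 1"
  from ord_ge_power[OF this, of 11] show "r \<in> radical mfps_ring jac_ideal"
    using ord_ge_11_subset_jac_ideal by (auto simp: radical_def)
qed

text \<open>Any b outside the radical is a unit, so a is recovered from a b by multiplying with the
  inverse of b.\<close>

lemma primary_to_jac_ideal: "primary_to mfps_ring mfps_max_ideal jac_ideal"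
proof -
  have "1 \<notin> jac_ideal"
    using jac_ideal_subset by (auto simp: ord_ge_def dest!: subsetD spec[of _ "\<lambda>_. 0"])
  moreover have "a \<in> jac_ideal" if "a * b \<in> jac_ideal" "b \<notin> ord_ge 1" for a b
  proof -
    obtain c where "b * c = 1"
      using mfps_unit[OF \<open>b \<notin> ord_ge 1\<close>] by blast
    then have "c * (a * b) = a"
      by (metis mult.assoc mult.commute mult_1)
    then show ?thesis
      using ideal_typeD(3)[OF ideal_jac_ideal that(1), of c] by simp
  qed
  ultimately show ?thesis
    unfolding primary_to_def primary_ideal_def radical_jac_ideal max_ideal_eq
    using ideal_jac_ideal by auto
qed

section \<open>The colon ideal\<close>

text \<open>The additive form avoids truncated subtraction.\<close>

lemma mdeg_upd: "mdeg (m(i := k)) + m i = mdeg m + k"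
proof -
  have "mdeg (m(i := k)) = k + (\<Sum>j\<in>UNIV - {i}. m j)" "mdeg m = m i + (\<Sum>j\<in>UNIV - {i}. m j)"
    unfolding mdeg_def by (subst sum.remove[of UNIV i]; simp)+
  then show ?thesis by simp
qed

lemma le_mdeg: "m i \<le> mdeg m"
  using mdeg_upd[of m i 0] by simp

lemma mfps_coeff_of_nat_mult:
  "mfps_coeff (of_nat k * h :: ('a::comm_ring_1, 'n::finite) mfps) m = of_nat k * mfps_coeff h m"
  by (simp add: mfps_of_nat_const mfps_coeff_const_mult)

lemma mfps_coeff_lin_mult:
  "mfps_coeff (lin * h) m = (\<Sum>i\<in>UNIV. if 0 < m i then mfps_coeff h (m(i := m i - 1)) else 0)"
  by (simp add: sum_distrib_right mfps_coeff_X_mult)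

lemma mfps_coeff_lin_power_neq_0: "mfps_coeff (lin ^ n) m \<noteq> 0 \<Longrightarrow> mdeg m = n"
proof (induction n arbitrary: m)
  case 0
  then show ?case by (auto split: if_splits)
next
  case (Suc n)
  then obtain i where "0 < m i" "mfps_coeff (lin ^ n) (m(i := m i - 1)) \<noteq> 0"
    unfolding power_Suc mfps_coeff_lin_mult
    by (elim sum.not_neutral_contains_not_neutral) (auto split: if_splits)
  then show ?case
    using Suc.IH[of "m(i := m i - 1)"] mdeg_upd[of m i "m i - 1"] by linarith
qed

text \<open>Since \<open>lin ^ n\<close> is homogeneous of degree n, only the part of h in degree
  \<open>mdeg m\<close> - n matters.\<close>

lemma mfps_coeff_mult_lin_power_eq_0:
  assumes "\<And>b. mdeg b + n = mdeg m \<Longrightarrow> mfps_coeff h b = 0"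
  shows "mfps_coeff (h * lin ^ n) m = 0"
  unfolding mfps_coeff_mult
proof (rule sum.neutral, clarify)
  fix b c assume "(b, c) \<in> exponent_splits m"
  then have "mdeg m = mdeg b + mdeg c"
    by (rule mdeg_splits)
  then show "mfps_coeff h b * mfps_coeff (lin ^ n) c = 0"
    using assms[of b] mfps_coeff_lin_power_neq_0[of n c] by fastforce
qed

lemma mfps_coeff_sum_jac_gen:
  "mfps_coeff (\<Sum>i\<in>UNIV. c i * jac_gen i) m =
    (\<Sum>i\<in>UNIV. if 3 \<le> m i then mfps_coeff (c i) (m(i := m i - 3)) else 0)
    + 5 * (\<Sum>i\<in>UNIV. mfps_coeff (c i * lin ^ 4) m)"
proof -
  have "c i * jac_gen i = mfps_X i ^ 3 * c i + of_nat 5 * (c i * lin ^ 4)" for i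
    by (simp add: jac_gen_def algebra_simps)
  then show ?thesis
    by (simp only: mfps_coeff_sum mfps_coeff_simps mfps_coeff_X_power_mult mfps_coeff_of_nat_mult
        sum.distrib sum_distrib_left) simp
qed

text \<open>
  The only syzygies of \<open>x\<^sub>1\<^sup>3, \<dots>, x\<^sub>5\<^sup>3\<close> in degree at most 6 are combinations of Koszul
  syzygies, whose entries lie in the ideal of the cubes. Hence the low coefficients of the \<open>c\<^sub>i\<close>
  at cube-free exponents vanish.
\<close>
lemma jac_syzygy_coeff_eq_0:
  assumes ord: "(\<Sum>i\<in>UNIV. c i * jac_gen i) \<in> ord_ge 7"
    and b: "mdeg b \<le> 3" "\<And>j. b j \<le> 2"
  shows "mfps_coeff (c i) b = 0"
  using b
proof (induction "mdeg b" arbitrary: b i rule: less_induct)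
  case less
  \<comment> \<open>As b is cube-free, x_i is the only variable whose cube divides this monomial, so
    the cubes contribute exactly the coefficient of \<open>c i\<close> at b.\<close>
  define m where "m = b(i := b i + 3)"
  have mdeg_m: "mdeg m = mdeg b + 3"
    using mdeg_upd[of b i "b i + 3"] by (simp add: m_def)
  \<comment> \<open>These terms see \<open>c j\<close> only in degree \<open>mdeg b\<close> - 1,
    which is at most 2, so all exponents there are cube-free and the induction hypothesis
    applies.\<close>
  have "mfps_coeff (c j * lin ^ 4) m = 0" for j
  proof (rule mfps_coeff_mult_lin_power_eq_0)
    fix a :: "5 \<Rightarrow> nat" assume a: "mdeg a + 4 = mdeg m"
    then have "mdeg a \<le> 2"
      using mdeg_m less.prems by simp
    then have "a k \<le> 2" for k
      using le_mdeg[of a k] by simp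
    then show "mfps_coeff (c j) a = 0"
      using a mdeg_m less.prems by (intro less.hyps) auto
  qed
  moreover have "(if 3 \<le> m j then mfps_coeff (c j) (m(j := m j - 3)) else 0) =
      (if j = i then mfps_coeff (c i) b else 0)" for j
    using less.prems(2)[of j] by (auto simp: m_def)
  ultimately have "mfps_coeff (\<Sum>i\<in>UNIV. c i * jac_gen i) m = mfps_coeff (c i) b"
    unfolding mfps_coeff_sum_jac_gen by simp
  moreover have "mfps_coeff (\<Sum>i\<in>UNIV. c i * jac_gen i) m = 0"
    using less.prems(1) by (intro ord_geD[OF ord]) (simp add: mdeg_m)
  ultimately show ?case by simp
qed

text \<open>At a cube-free exponent the cubes contribute nothing. The remaining terms involve the
  \<open>c j\<close> at divisors of degree 3, again cube-free, where
  \<open>jac_syzygy_coeff_eq_0\<close> gives zero.\<close>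

lemma jac_coeff_7_eq_0:
  assumes ord: "(\<Sum>i\<in>UNIV. c i * jac_gen i) \<in> ord_ge 7"
    and m: "mdeg m = 7" "\<And>j. m j \<le> 2"
  shows "mfps_coeff (\<Sum>i\<in>UNIV. c i * jac_gen i) m = 0"
proof -
  have "\<not> 3 \<le> m j" for j
    using m(2)[of j] by simp
  moreover have "mfps_coeff (c j * lin ^ 4) m = 0" for j
    unfolding mfps_coeff_mult
  proof (rule sum.neutral, clarify)
    fix a b assume ab: "(a, b) \<in> exponent_splits m"
    then have "a k \<le> m k" for k
      by (auto simp: exponent_splits_def) (metis le_add1)
    then have "a k \<le> 2" for k
      using m(2)[of k] order_trans by blast
    then have "mfps_coeff (c j) a = 0" if "mdeg b = 4"
      using mdeg_splits[OF ab] m(1) that by (intro jac_syzygy_coeff_eq_0[OF ord]) auto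
    then show "mfps_coeff (c j) a * mfps_coeff (lin ^ 4) b = 0"
      using mfps_coeff_lin_power_neq_0[of 4 b] by fastforce
  qed
  ultimately show ?thesis
    unfolding mfps_coeff_sum_jac_gen by simp
qed

section \<open>Multiplication by powers of the linear form on quadratic parts\<close>

definition mfact :: "('n::finite \<Rightarrow> nat) \<Rightarrow> rat" where
  "mfact m = (\<Prod>i\<in>UNIV. fact (m i))"

lemma mfact_neq_0: "mfact m \<noteq> 0"
  by (simp add: mfact_def)

lemma mfact_reduce:
  assumes "0 < m i"
  shows "mfact m = of_nat (m i) * mfact (m(i := m i - 1))"
proof -
  have "mfact m = fact (m i) * (\<Prod>j\<in>UNIV - {i}. fact (m j))"
    unfolding mfact_def by (rule prod.remove) auto
  moreover have "mfact (m(i := m i - 1)) = fact (m i - 1) * (\<Prod>j\<in>UNIV - {i}. fact (m j))"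
    unfolding mfact_def by (subst prod.remove[of UNIV i]) auto
  moreover have "fact (m i) = (of_nat (m i) * fact (m i - 1) :: rat)"
    using assms by (simp add: fact_reduce)
  ultimately show ?thesis by simp
qed

text \<open>In the basis of divided powers, multiplication by the linear form is a weighted shift;
  the weight \<open>m i\<close> replaces the case distinction on divisibility.\<close>

lemma mfact_coeff_lin_mult:
  "mfact m * mfps_coeff (lin * h) m =
    (\<Sum>i\<in>UNIV. of_nat (m i) * (mfact (m(i := m i - 1)) * mfps_coeff h (m(i := m i - 1))))"
  unfolding mfps_coeff_lin_mult sum_distrib_left
  by (intro sum.cong) (auto simp: mfact_reduce)

definition kron :: "'n \<Rightarrow> 'n \<Rightarrow> rat" where
  "kron i j = (if i = j then 1 else 0)"

text \<open>
  The factor \<open>m\<^sub>i (m\<^sub>j - \<delta>\<^sub>i\<^sub>j)\<close> is \<open>m! / (m - e\<^sub>i - e\<^sub>j)!\<close>, which turns the multinomial coefficients of \<open>\<ell>\<^sup>n\<close>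
  into a polynomial in \<open>m\<close>.
\<close>
definition quad :: "('n \<Rightarrow> 'n \<Rightarrow> rat) \<Rightarrow> ('n::finite \<Rightarrow> nat) \<Rightarrow> rat" where
  "quad G m = (\<Sum>i\<in>UNIV. \<Sum>j\<in>UNIV. of_nat (m i) * (of_nat (m j) - kron i j) * G i j)"

text \<open>For each pair i, j, both m_k times the factor at m - e_k and the factor at m times (m -
  e_i - e_j)_k equal m! / (m - e_i - e_j - e_k)!. Summing (m - e_i - e_j)_k over k gives |m| -
  2.\<close>

lemma quad_step:
  "(\<Sum>k\<in>UNIV. of_nat (m k) * quad G (m(k := m k - 1))) = (of_nat (mdeg m) - 2) * quad G m"
proof -
  define r where "r i = (of_nat (m i) :: rat)" for i
  have sum_r: "(\<Sum>k\<in>UNIV. r k) = of_nat (mdeg m)"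
    by (simp add: r_def mdeg_def)
  have inner: "(\<Sum>k\<in>UNIV. r k * ((r i - kron i k) * (r j - kron j k - kron i j))) =
      (of_nat (mdeg m) - 2) * (r i * (r j - kron i j))" for i j
  proof -
    have "r k * ((r i - kron i k) * (r j - kron j k - kron i j)) =
        r k * (r i * (r j - kron i j)) - (if k = j then r k * r i else 0)
        - (if k = i then r k * (r j - kron i j) else 0) + (if k = i then r i * kron i j else 0)" for k
      by (auto simp: kron_def algebra_simps)
    then have "(\<Sum>k\<in>UNIV. r k * ((r i - kron i k) * (r j - kron j k - kron i j))) =
        (\<Sum>k\<in>UNIV. r k) * (r i * (r j - kron i j)) - r j * r i - r i * (r j - kron i j) + r i * kron i j"
      by (simp add: sum.distrib sum_subtractf flip: sum_distrib_right)
    then show ?thesis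
      by (simp add: sum_r algebra_simps)
  qed
  \<comment> \<open>For \<open>m k = 0\<close> the truncated \<open>m k - 1\<close> is not the
    rational \<open>r k - 1\<close>, but the factor in front is zero.\<close>
  have "of_nat (m k) * quad G (m(k := m k - 1)) =
      (\<Sum>i\<in>UNIV. \<Sum>j\<in>UNIV. r k * ((r i - kron i k) * (r j - kron j k - kron i j)) * G i j)" for k
  proof (cases "m k = 0")
    case False
    then have "of_nat ((m(k := m k - 1)) i) = r i - kron i k" for i
      by (simp add: r_def kron_def of_nat_diff)
    then show ?thesis
      by (simp add: quad_def r_def sum_distrib_left mult.assoc)
  qed (simp add: r_def)
  then have "(\<Sum>k\<in>UNIV. of_nat (m k) * quad G (m(k := m k - 1))) =
      (\<Sum>k\<in>UNIV. \<Sum>i\<in>UNIV. \<Sum>j\<in>UNIV. r k * ((r i - kron i k) * (r j - kron j k - kron i j)) * G i j)"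
    by simp
  also have "\<dots> = (\<Sum>i\<in>UNIV. \<Sum>k\<in>UNIV. \<Sum>j\<in>UNIV. r k * ((r i - kron i k) * (r j - kron j k - kron i j)) * G i j)"
    by (rule sum.swap)
  also have "\<dots> = (\<Sum>i\<in>UNIV. \<Sum>j\<in>UNIV. \<Sum>k\<in>UNIV. r k * ((r i - kron i k) * (r j - kron j k - kron i j)) * G i j)"
    by (intro sum.cong refl sum.swap)
  also have "\<dots> = (of_nat (mdeg m) - 2) * quad G m"
    unfolding sum_distrib_right[symmetric] inner
    by (simp add: quad_def sum_distrib_left r_def mult.assoc)
  finally show ?thesis .
qed

definition pair_exp :: "'n \<Rightarrow> 'n \<Rightarrow> 'n \<Rightarrow> nat" where
  "pair_exp p q k = (if k = p then 1 else 0) + (if k = q then 1 else 0)"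

lemma mdeg_2_pair_exp:
  assumes "mdeg m = 2"
  obtains p q where "m = pair_exp p q"
proof -
  have ex: "\<exists>p. 0 < m' p" if "mdeg m' > 0" for m' :: "'a \<Rightarrow> nat"
    using that mdeg_eq_0_iff[of m'] by fastforce
  obtain p where p: "0 < m p"
    using ex[of m] assms by auto
  define m1 where "m1 = m(p := m p - 1)"
  have m1: "mdeg m1 = 1"
    using mdeg_upd[of m p "m p - 1"] p assms by (simp add: m1_def)
  then obtain q where q: "0 < m1 q"
    using ex[of m1] by auto
  have "mdeg (m1(q := m1 q - 1)) = 0"
    using mdeg_upd[of m1 q "m1 q - 1"] q m1 by simp
  then have "m1(q := m1 q - 1) = (\<lambda>_. 0)"
    by (simp add: mdeg_eq_0_iff)
  then have "m k = pair_exp p q k" for k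
    using p q by (auto simp: m1_def pair_exp_def fun_eq_iff split: if_splits dest!: spec[of _ k])
  then show ?thesis
    using that by blast
qed

text \<open>The Hessian matrix of g at the origin; the factorial supplies the 2 on the
  diagonal.\<close>

definition quad_coeff :: "(rat, 'n::finite) mfps \<Rightarrow> 'n \<Rightarrow> 'n \<Rightarrow> rat" where
  "quad_coeff g i j = mfact (pair_exp i j) * mfps_coeff g (pair_exp i j)"

lemma pair_exp_commute: "pair_exp p q = pair_exp q p"
  by (auto simp: pair_exp_def)

lemma quad_coeff_commute: "quad_coeff g p q = quad_coeff g q p"
  by (simp add: quad_coeff_def pair_exp_commute[of p q])

lemma quad_pair_exp: "quad G (pair_exp p q) = G p q + G q p"
proof -
  have e: "of_nat (pair_exp p q i) = kron i p + kron i q" for i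
    by (simp add: pair_exp_def kron_def)
  have k: "(\<Sum>j\<in>UNIV. kron j x * H j) = H x" "(\<Sum>j\<in>UNIV. kron x j * H j) = H x"
    for x :: 'a and H :: "'a \<Rightarrow> rat"
    by (simp_all add: kron_def if_distrib[of "\<lambda>c. c * _"] cong: if_cong)
  have "quad G (pair_exp p q) =
      (\<Sum>i\<in>UNIV. (kron i p + kron i q) * (\<Sum>j\<in>UNIV. (kron j p + kron j q - kron i j) * G i j))"
    by (simp add: quad_def e sum_distrib_left mult.assoc)
  also have "\<dots> = (\<Sum>i\<in>UNIV. (kron i p + kron i q) * (G i p + G i q - G i i))"
    by (simp add: distrib_right left_diff_distrib sum.distrib sum_subtractf k)
  also have "\<dots> = G p q + G q p"
    by (simp add: distrib_right sum.distrib k)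
  finally show ?thesis .
qed

text \<open>Both sides obey the same recursion in n, by \<open>mfact_coeff_lin_mult\<close> and by
  \<open>quad_step\<close> with |m| - 2 = n + 1. The factor 2 arises in degree two, where
  \<open>quad_pair_exp\<close> meets each entry of a symmetric matrix twice.\<close>

lemma coeff_lin_power_mult:
  assumes "mdeg m = n + 2"
  shows "2 * (mfact m * mfps_coeff (lin ^ n * g) m) = fact n * quad (quad_coeff g) m"
  using assms
proof (induction n arbitrary: m)
  case 0
  then have "mdeg m = 2" by simp
  then obtain p q where "m = pair_exp p q"
    by (rule mdeg_2_pair_exp)
  then show ?case
    using quad_coeff_commute[of g q p] by (simp add: quad_pair_exp) (simp add: quad_coeff_def)
next
  case (Suc n)
  have "2 * (mfact m * mfps_coeff (lin ^ Suc n * g) m) =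
      (\<Sum>i\<in>UNIV. of_nat (m i) * (2 * (mfact (m(i := m i - 1)) * mfps_coeff (lin ^ n * g) (m(i := m i - 1)))))"
    unfolding power_Suc mult.assoc[of lin] mfact_coeff_lin_mult sum_distrib_left
    by (simp add: mult.left_commute)
  also have "\<dots> = (\<Sum>i\<in>UNIV. of_nat (m i) * (fact n * quad (quad_coeff g) (m(i := m i - 1))))"
  proof (rule sum.cong)
    fix i
    show "of_nat (m i) * (2 * (mfact (m(i := m i - 1)) * mfps_coeff (lin ^ n * g) (m(i := m i - 1)))) =
        of_nat (m i) * (fact n * quad (quad_coeff g) (m(i := m i - 1)))"
    proof (cases "m i = 0")
      case False
      then have "mdeg (m(i := m i - 1)) = n + 2"
        using mdeg_upd[of m i "m i - 1"] Suc.prems by simp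
      from Suc.IH[OF this] show ?thesis
        by (simp only:)
    qed simp
  qed simp
  also have "\<dots> = fact n * ((of_nat (mdeg m) - 2) * quad (quad_coeff g) m)"
    unfolding quad_step[symmetric] sum_distrib_left by (simp add: mult.left_commute)
  also have "\<dots> = fact (Suc n) * quad (quad_coeff g) m"
    using Suc.prems by (simp add: algebra_simps)
  finally show ?case .
qed

text \<open>Up to permutation, the cube-free exponents of degree 7 are (2,2,1,1,1) and (0,1,2,2,2).
  The equations are the corresponding values of \<open>quad\<close>, halved by symmetry.\<close>

lemma quad_eqs:
  fixes G :: "5 \<Rightarrow> 5 \<Rightarrow> rat"
  assumes zero: "\<And>m. mdeg m = 7 \<Longrightarrow> (\<And>j. m j \<le> 2) \<Longrightarrow> quad G m = 0"
    and sym: "\<And>i j. G i j = G j i"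
    and dist: "distinct [a, b, c, d, e]"
  shows "G a a + G b b + 4 * G a b + 2 * (G a c + G a d + G a e + G b c + G b d + G b e)
      + (G c d + G c e + G d e) = 0"
    and "G c c + G d d + G e e + 2 * (G b c + G b d + G b e) + 4 * (G c d + G c e + G d e) = 0"
proof -
  have UNIV: "(UNIV :: 5 set) = {a, b, c, d, e}"
    using dist by (intro card_subset_eq[symmetric]) auto
  have ne: "a \<noteq> b" "a \<noteq> c" "a \<noteq> d" "a \<noteq> e" "b \<noteq> c" "b \<noteq> d" "b \<noteq> e" "c \<noteq> d" "c \<noteq> e" "d \<noteq> e"
    using dist by auto
  note ne = ne ne[symmetric]
  note syms = sym[of b a] sym[of c a] sym[of d a] sym[of e a] sym[of c b] sym[of d b] sym[of e b]
    sym[of d c] sym[of e c] sym[of e d]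
  have "quad G ((\<lambda>_. 1)(a := 2, b := 2)) = 0"
  proof (rule zero)
    show "mdeg ((\<lambda>_. 1)(a := 2, b := 2)) = 7"
      by (simp add: mdeg_def UNIV ne)
  qed simp
  then show "G a a + G b b + 4 * G a b + 2 * (G a c + G a d + G a e + G b c + G b d + G b e)
      + (G c d + G c e + G d e) = 0"
    using syms by (simp add: quad_def UNIV kron_def ne)
  have "quad G ((\<lambda>_. 2)(a := 0, b := 1)) = 0"
  proof (rule zero)
    show "mdeg ((\<lambda>_. 2)(a := 0, b := 1)) = 7"
      by (simp add: mdeg_def UNIV ne)
  qed simp
  then show "G c c + G d d + G e e + 2 * (G b c + G b d + G b e) + 4 * (G c d + G c e + G d e) = 0"
    using syms by (simp add: quad_def UNIV kron_def ne)
qed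

text \<open>The strong Lefschetz property from degree 2 to degree 7, in terms of the Hessian. It is
  proved by eliminating in the linear system of \<open>quad_eqs\<close>.\<close>

lemma quad_nondegenerate:
  fixes G :: "5 \<Rightarrow> 5 \<Rightarrow> rat"
  assumes zero: "\<And>m. mdeg m = 7 \<Longrightarrow> (\<And>j. m j \<le> 2) \<Longrightarrow> quad G m = 0"
    and sym: "\<And>i j. G i j = G j i"
  shows "G a b = 0"
proof -
  have eqs:
    "G a a + G b b + 4 * G a b + 2 * (G a c + G a d + G a e + G b c + G b d + G b e)
      + (G c d + G c e + G d e) = 0"
    "G c c + G d d + G e e + 2 * (G b c + G b d + G b e) + 4 * (G c d + G c e + G d e) = 0"
    if "distinct [a, b, c, d, e]" for a b c d e
    using quad_eqs[of G a b c d e, OF _ sym that] zero by blast+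
  \<comment> \<open>The sum of the last two equations minus twice the first leaves exactly G p p + G
    q q - 2 G p q.\<close>
  have mid: "2 * G p q = G p p + G q q" if "distinct [p, q, r, s, t]" for p q r s t
  proof -
    have d: "distinct [r, t, p, q, s]" "distinct [q, s, p, r, t]" "distinct [p, s, q, r, t]"
      using that by auto
    show ?thesis
      using eqs(1)[OF d(1)] eqs(2)[OF d(2)] eqs(2)[OF d(3)]
        sym[of r p] sym[of r q] sym[of s p] sym[of s q] sym[of s r] sym[of t p] sym[of t q] sym[of t s]
      unfolding distrib_left by linarith
  qed
  \<comment> \<open>Substituting \<open>mid\<close> turns the second equation into 3 G q q + 6 (G r
    r + G s s + G t t) = 0.\<close>
  have diag: "G q q = - 2 * (G r r + G s s + G t t)" if "distinct [p, q, r, s, t]" for p q r s t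
  proof -
    have d: "distinct [q, r, p, s, t]" "distinct [q, s, p, r, t]" "distinct [q, t, p, r, s]"
      "distinct [r, s, p, q, t]" "distinct [r, t, p, q, s]" "distinct [s, t, p, q, r]"
      using that by auto
    show ?thesis
      using eqs(2)[OF that] mid[OF d(1)] mid[OF d(2)] mid[OF d(3)] mid[OF d(4)] mid[OF d(5)] mid[OF d(6)]
      unfolding distrib_left by linarith
  qed
  \<comment> \<open>Among any four diagonal entries, each is -2 times the sum of the other three.
    Hence all four agree with some x satisfying x = -6 x.\<close>
  have G0: "G p p = 0 \<and> G p q = 0" if dist: "distinct [p, q, r, s, t]" for p q r s t
  proof -
    have d: "distinct [q, p, r, s, t]" "distinct [r, p, q, s, t]" "distinct [p, r, q, s, t]"
      "distinct [s, p, q, r, t]" "distinct [p, s, q, r, t]" "distinct [t, p, q, r, s]" "distinct [p, t, q, r, s]"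
      using that by auto
    note eq = diag[OF dist] diag[OF d(1)] diag[OF d(2)] diag[OF d(3)] diag[OF d(4)] diag[OF d(5)]
      diag[OF d(6)] diag[OF d(7)]
    have "G p p = 0" "G q q = 0"
      using eq unfolding distrib_left by linarith+
    with mid[OF dist] show ?thesis by simp
  qed
  have "card (UNIV - {a, b}) \<ge> 3"
    by (cases "a = b") (auto simp: card_Diff_subset)
  then obtain S where S: "S \<subseteq> UNIV - {a, b}" "card S = 3"
    by (rule obtain_subset_with_card_n)
  then obtain r s t where S_eq: "S = {r, s, t}" "r \<noteq> s" "s \<noteq> t" "r \<noteq> t"
    by (auto simp: card_3_iff)
  show ?thesis
  proof (cases "a = b")
    case True
    have "card (UNIV - {a, r, s, t}) > 0"
      using S S_eq True by (subst card_Diff_subset) auto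
    then obtain u where "u \<notin> {a, r, s, t}"
      by (auto simp: card_gt_0_iff)
    then have "distinct [a, r, s, t, u]"
      using S S_eq by auto
    from G0[OF this] True show ?thesis by simp
  next
    case False
    then have "distinct [a, b, r, s, t]"
      using S S_eq by auto
    from G0[OF this] show ?thesis by simp
  qed
qed

text \<open>The product has order at least 7, so its cube-free coefficients in degree 7 vanish by
  \<open>jac_coeff_7_eq_0\<close>. Up to nonzero factors they are the values of \<open>quad\<close>
  at the Hessian of g, which is therefore zero.\<close>

lemma ord_2_times_lin_power_5:
  assumes g: "g \<in> ord_ge 2" and J: "g * lin ^ 5 \<in> jac_ideal"
  shows "g \<in> ord_ge 3"
proof -
  obtain c where c: "g * lin ^ 5 = (\<Sum>i\<in>UNIV. c i * jac_gen i)"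
    using J unfolding jac_ideal_eq by blast
  have ord: "(\<Sum>i\<in>UNIV. c i * jac_gen i) \<in> ord_ge 7"
    using ord_ge_mult[OF g lin_power_in_ord_ge[of 5]] by (simp add: c)
  have "quad (quad_coeff g) m = 0" if m: "mdeg m = 7" "\<And>j. m j \<le> 2" for m
    using coeff_lin_power_mult[of m 5 g] jac_coeff_7_eq_0[OF ord m] m
    by (simp add: mult.commute[of _ g] c)
  then have G: "quad_coeff g p q = 0" for p q
    by (rule quad_nondegenerate) (auto intro: quad_coeff_commute)
  have "mfps_coeff g m = 0" if m: "mdeg m = 2" for m
  proof -
    obtain p q where "m = pair_exp p q"
      using m by (rule mdeg_2_pair_exp)
    then show ?thesis
      using G[of p q] by (simp add: quad_coeff_def mfact_neq_0)
  qed
  moreover have "mfps_coeff g m = 0" if "mdeg m < 2" for m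
    using ord_geD[OF g that] .
  ultimately show ?thesis
    by (auto simp: ord_ge_def less_Suc_eq numeral_3_eq_3 numeral_2_eq_2)
qed

lemma colon_lin_power_5:
  assumes J: "g * lin ^ 5 \<in> jac_ideal"
  shows "g \<in> ord_ge 3"
proof (rule ccontr)
  assume "g \<notin> ord_ge 3"
  then obtain d a where d: "d < 3" "g \<in> ord_ge d" "mdeg a = d" "mfps_coeff g a \<noteq> 0"
    by (rule not_ord_ge_least)
  \<comment> \<open>Raises the order to 2 without leaving the colon ideal; the nonzero coefficient
    of g at a survives as a shifted coefficient of degree 2.\<close>
  define h where "h = mfps_X 0 ^ (2 - d) * g"
  have "h \<in> ord_ge (2 - d + d)"
    unfolding h_def by (intro ord_ge_mult X_power_in_ord_ge d)
  moreover have "h * lin ^ 5 \<in> jac_ideal"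
    using ideal_typeD(3)[OF ideal_jac_ideal J] by (simp add: h_def mult.assoc)
  ultimately have "h \<in> ord_ge 3"
    using d(1) by (intro ord_2_times_lin_power_5) auto
  moreover have "mdeg (a(0 := a 0 + (2 - d))) < 3"
    using mdeg_upd[of a 0 "a 0 + (2 - d)"] d by simp
  ultimately have "mfps_coeff h (a(0 := a 0 + (2 - d))) = 0"
    by (rule ord_geD)
  then show False
    using d(4) by (simp add: h_def mfps_coeff_X_power_mult)
qed

theorem theorem7p2:
  fixes l f :: "(rat, 5) mfps"
  assumes l_eq: "l = (\<Sum>i\<in>UNIV. mfps_X i)"
    and f_eq: "f = mfps_const (1 / 4) * (\<Sum>i\<in>UNIV. mfps_X i ^ 4) + l ^ 5"
  shows "isolated_hypersurface_singularity f \<and>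
    colon_elem mfps_ring (jacobian_ideal f) f \<subseteq> integral_closure mfps_ring (jacobian_ideal f) \<and>
    integral_closure mfps_ring (jacobian_ideal f) = ideal_power mfps_ring mfps_max_ideal 3"
proof -
  have J: "jacobian_ideal f = jac_ideal"
    unfolding jacobian_ideal_def f_eq l_eq pderiv_eq_jac_gen ..
  have "f \<in> ord_ge 1"
    unfolding f_eq l_eq
  proof (intro ord_ge_add)
    show "mfps_const (1 / 4) * (\<Sum>i\<in>UNIV. mfps_X i ^ 4) \<in> (ord_ge 1 :: (rat, 5) mfps set)"
      by (intro ord_ge_multI[of "sum _ _"] ord_ge_sum subsetD[OF ord_ge_antimono X_power_in_ord_ge]) simp
    show "lin ^ 5 \<in> ord_ge 1"
      by (rule subsetD[OF ord_ge_antimono lin_power_in_ord_ge]) simp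
  qed
  then have "isolated_hypersurface_singularity f"
    unfolding isolated_hypersurface_singularity_def J using primary_to_jac_ideal by (simp add: max_ideal_eq)
  moreover have "colon_elem mfps_ring jac_ideal f \<subseteq> ord_ge 3"
  proof
    fix g assume "g \<in> colon_elem mfps_ring jac_ideal f"
    then have gf: "g * f \<in> jac_ideal"
      by (simp add: colon_elem_def)
    \<comment> \<open>Euler's relation: the generators weighted by the variables sum to the fourth
      powers plus 5 \<open>lin\<close>^5, whereas 4 f contains 4 \<open>lin\<close>^5. The
      difference is \<open>lin\<close>^5.\<close>
    have "4 * f = (4 * mfps_const (1 / 4)) * (\<Sum>i\<in>UNIV. mfps_X i ^ 4) + 4 * lin ^ 5"
      unfolding f_eq l_eq by (simp only: distrib_left mult.assoc)
    then have f4: "4 * f = (\<Sum>i\<in>UNIV. mfps_X i ^ 4) + 4 * lin ^ 5"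
      by (simp only: const_quarter mult_1)
    have "mfps_X i * jac_gen i = mfps_X i ^ 4 + mfps_X i * (5 * lin ^ 4)" for i
      by (simp add: jac_gen_def distrib_left flip: power_Suc)
    then have "(\<Sum>i\<in>UNIV. mfps_X i * jac_gen i) = (\<Sum>i\<in>UNIV. mfps_X i ^ 4) + lin * (5 * lin ^ 4)"
      by (simp only: sum.distrib sum_distrib_right)
    moreover have "lin * (5 * lin ^ 4) = 5 * lin ^ 5"
      by (simp only: mult.left_commute[of lin] flip: power_Suc) simp
    ultimately have "lin ^ 5 = (\<Sum>i\<in>UNIV. mfps_X i * jac_gen i) - 4 * f"
      unfolding f4 by (simp only:) (simp add: algebra_simps)
    then have eq: "g * lin ^ 5 = g * (\<Sum>i\<in>UNIV. mfps_X i * jac_gen i) - 4 * (g * f)"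
      by (simp only: right_diff_distrib mult.left_commute)
    have "g * lin ^ 5 \<in> jac_ideal"
      unfolding eq
      by (intro ideal_type_diff ideal_typeD(3)[OF ideal_jac_ideal] ideal_type_sum ideal_jac_ideal
          jac_gen_in_jac_ideal gf)
    then show "g \<in> ord_ge 3"
      by (rule colon_lin_power_5)
  qed
  ultimately show ?thesis
    unfolding J integral_closure_jac_ideal max_ideal_power_eq by blast
qed

end
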